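(* Let $n\geq 1$, let $(\mathcal{C},\mathcal{X})$ be an $n$-exact category and suppose $\mathscr{F}\colon\mathcal{C}\to\mathcal{C}'$ is an equivalence of categories. Let $\mathcal{X}'$ be the class of all ($n$-exact) sequences in $\mathcal{C}'$ that are weakly isomorphic to some sequence of the form $$\mathscr{F}X^0\xrightarrow{\mathscr{F}d_X^0}\mathscr{F}X^1\xrightarrow{\mathscr{F}d_X^1}\cdots\xrightarrow{\mathscr{F}d_X^n}\mathscr{F}X^{n+1},$$ where $X^0\xrightarrow{d_X^0}X^1\xrightarrow{d_X^1}\cdots\xrightarrow{d_X^n}X^{n+1}$ is an $\mathcal{X}$-admissible $n$-exact sequence. Then $(\mathcal{C}',\mathcal{X}')$ is an $n$-exact category and $\mathscr{F}$ is an $n$-exact equivalence.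
   Context: Fix an integer $n\geq 1$ and an additive category $\mathcal{C}$. Let $\mathsf{C}^m_{\mathcal{C}}$ denote the category of cochain complexes in $\mathcal{C}$ concentrated in degrees $0,\dots,m+1$. **$n$-kernels, $n$-exact sequences.** An $n$-kernel of $d_X^n\colon X^n\to X^{n+1}$ is a sequence $(d_X^0,\dots,d_X^{n-1})$ of composable morphisms $X^0\xrightarrow{d_X^0}X^1\to\cdots\xrightarrow{d_X^{n-1}}X^n$ such that $0\to\mathcal{C}(Z,X^0)\to\mathcal{C}(Z,X^1)\to\cdots\to\mathcal{C}(Z,X^n)\to\mathcal{C}(Z,X^{n+1})$ is exact for all $Z\in\mathcal{C}$. An $n$-cokernel is defined dually. An $n$-exact sequence is a complex $X^\bullet\in\mathsf{C}^n_{\mathcal{C}}$ such that $(d_X^0,\dots,d_X^{n-1})$ is an $n$-kernel of $d_X^n$ and $(d_X^1,\dots,d_X^n)$ is an $n$-cokernel of $d_X^0$. A morphism of $n$-exact sequences is a morphism of complexes. **Mapping cone, $n$-pullback, $n$-pushout.** For a morphism $f^\bullet\colon X^\bullet\to Y^\bullet$ in $\mathsf{C}^{n-1}_{\mathcal{C}}$ the mapping cone is the complex $X^0\xrightarrow{d_C^{-1}}X^1\oplus Y^0\xrightarrow{d_C^0}X^2\oplus Y^1\to\cdots\to X^n\oplus Y^{n-1}\xrightarrow{d_C^{n-1}}Y^n$ with $d_C^{-1}=\begin{pmatrix}-d_X^0\\ f^0\end{pmatrix}$, $d_C^{n-1}=(f^n\ \ d_Y^{n-1})$ and $d_C^i=\begin{pmatrix}-d_X^{i+1}&0\\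 f^{i+1}&d_Y^i\end{pmatrix}$ for $0\leq i\leq n-2$. Given $X^\bullet\in\mathsf{C}^{n-1}_{\mathcal{C}}$ and $g^n\colon Z^n\to X^n$, an $n$-pullback of $(d_X^0,\dots,d_X^{n-1})$ along $g^n$ is a morphism of complexes $g^\bullet\colon Z^\bullet\to X^\bullet$ in $\mathsf{C}^{n-1}_{\mathcal{C}}$ with $n$-th component $g^n$ such that, in its mapping cone, $(d_C^{-1},\dots,d_C^{n-2})$ is an $n$-kernel of $d_C^{n-1}$. Dually, an $n$-pushout of $(d_X^0,\dots,d_X^{n-1})$ along $f^0\colon X^0\to Y^0$ is a morphism of complexes $f^\bullet\colon X^\bullet\to Y^\bullet$ in $\mathsf{C}^{n-1}_{\mathcal{C}}$ with $0$-th component $f^0$ such that, in its mapping cone, $(d_C^0,\dots,d_C^{n-1})$ is an $n$-cokernel of $d_C^{-1}$. **$n$-exact categories.** A morphism $f^\bullet\colon X^\bullet\to Y^\bullet$ of $n$-exact sequences is a weak isomorphism if for some $i\in\{0,\dots,n+1\}$ both $f^i$ and $f^{i+1}$ are isomorphisms, where $f^{n+2}:=f^0$; in this case $X^\bullet$ and $Y^\bullet$ are called weakly isomorphic. Let $\mathcal{X}$ be a class of $n$-exact sequences in $\mathcal{C}$ closed under weak isomorphisms; its members are called $\mathcal{X}$-admissible $n$-exact sequences, and for $X^\bullet\in\mathcal{X}$, $d_X^0$ is an $\mathcal{X}$-admissible monomorphism and $d_X^n$ is an $\mathcal{X}$-admissible epimorphism. $(\mathcal{C},\mathcal{X})$ is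 an $n$-exact category if: ($n$-E0) $0\to0\to\cdots\to0$ is in $\mathcal{X}$; ($n$-E1) $\mathcal{X}$-admissible monomorphisms are closed under composition; ($n$-E1$^{\mathrm{op}}$) $\mathcal{X}$-admissible epimorphisms are closed under composition; ($n$-E2) for each $X^\bullet\in\mathcal{X}$ and each $f^0\colon X^0\to Y^0$ there is an $n$-pushout of $(d_X^0,\dots,d_X^{n-1})$ along $f^0$, with target $Y^0\xrightarrow{d_Y^0}\cdots\to Y^n$, such that $d_Y^0$ is an $\mathcal{X}$-admissible monomorphism; ($n$-E2$^{\mathrm{op}}$) the dual: for each $X^\bullet\in\mathcal{X}$ and each $g^{n+1}\colon Z^{n+1}\to X^{n+1}$ there is an $n$-pullback of $(d_X^1,\dots,d_X^n)$ along $g^{n+1}$, with source $Z^1\to\cdots\xrightarrow{d_Z^n}Z^{n+1}$, such that $d_Z^n$ is an $\mathcal{X}$-admissible epimorphism. **$n$-exact functors.** An additive covariant functor $\mathscr{F}\colon\mathcal{C}\to\mathcal{C}'$ between $n$-exact categories $(\mathcal{C},\mathcal{X})$, $(\mathcal{C}',\mathcal{X}')$ is $n$-exact if applying $\mathscr{F}$ degreewise sends every $\mathcal{X}$-admissible $n$-exact sequence to an $\mathcal{X}'$-admissible $n$-exact sequence. It is an $n$-exact equivalence if it is $n$-exact and an equivalence of categories. *)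

theory Defs
  imports "HOL-Algebra.Group"
begin

section \<open>Categories, functors and equivalences\<close>

record ('o, 'm) category =
  Obj :: "'o set"
  Arr :: "'m set"
  Dom :: "'m \<Rightarrow> 'o"
  Cod :: "'m \<Rightarrow> 'o"
  Ide :: "'o \<Rightarrow> 'm"
  Comp :: "'m \<Rightarrow> 'm \<Rightarrow> 'm" (infixr "\<cdot>\<index>" 72)

definition Hom :: "('o, 'm) category \<Rightarrow> 'o \<Rightarrow> 'o \<Rightarrow> 'm set" where
  "Hom C A B = {f \<in> Arr C. Dom C f = A \<and> Cod C f = B}"

locale category =
  fixes C :: "('o, 'm) category" (structure)
  assumes Dom_Obj: "f \<in> Arr C \<Longrightarrow> Dom C f \<in> Obj C"
    and Cod_Obj: "f \<in> Arr C \<Longrightarrow> Cod C f \<in> Obj C"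
    and Ide_Hom: "A \<in> Obj C \<Longrightarrow> Ide C A \<in> Hom C A A"
    and Comp_Hom: "\<lbrakk>f \<in> Hom C A B; g \<in> Hom C B D\<rbrakk> \<Longrightarrow> g \<cdot> f \<in> Hom C A D"
    and Comp_Ide: "f \<in> Hom C A B \<Longrightarrow> f \<cdot> Ide C A = f"
    and Ide_Comp: "f \<in> Hom C A B \<Longrightarrow> Ide C B \<cdot> f = f"
    and Comp_assoc:
      "\<lbrakk>f \<in> Hom C A B; g \<in> Hom C B D; h \<in> Hom C D E\<rbrakk> \<Longrightarrow> (h \<cdot> g) \<cdot> f = h \<cdot> (g \<cdot> f)"

definition iso_arr :: "('o, 'm) category \<Rightarrow> 'm \<Rightarrow> bool" where
  "iso_arr C f \<longleftrightarrow> f \<in> Arr C \<and>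
     (\<exists>g \<in> Hom C (Cod C f) (Dom C f).
        g \<cdot>\<^bsub>C\<^esub> f = Ide C (Dom C f) \<and> f \<cdot>\<^bsub>C\<^esub> g = Ide C (Cod C f))"

record ('o, 'm, 'p, 'k) cat_functor =
  fobj :: "'o \<Rightarrow> 'p"
  farr :: "'m \<Rightarrow> 'k"

definition is_functor ::
  "('o, 'm) category \<Rightarrow> ('p, 'k) category \<Rightarrow> ('o, 'm, 'p, 'k) cat_functor \<Rightarrow> bool" where
  "is_functor C C' F \<longleftrightarrow>
     (\<forall>A \<in> Obj C. fobj F A \<in> Obj C') \<and>
     (\<forall>A B. \<forall>f \<in> Hom C A B. farr F f \<in> Hom C' (fobj F A) (fobj F B)) \<and>
     (\<forall>A \<in> Obj C. farr F (Ide C A) = Ide C' (fobj F A)) \<and>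
     (\<forall>A B D. \<forall>f \<in> Hom C A B. \<forall>g \<in> Hom C B D.
        farr F (g \<cdot>\<^bsub>C\<^esub> f) = farr F g \<cdot>\<^bsub>C'\<^esub> farr F f)"

definition id_functor :: "('o, 'm, 'o, 'm) cat_functor" where
  "id_functor = \<lparr>fobj = (\<lambda>A. A), farr = (\<lambda>f. f)\<rparr>"

definition comp_functor ::
  "('p, 'k, 'q, 'l) cat_functor \<Rightarrow> ('o, 'm, 'p, 'k) cat_functor \<Rightarrow> ('o, 'm, 'q, 'l) cat_functor"
  where
  "comp_functor G F = \<lparr>fobj = (\<lambda>A. fobj G (fobj F A)), farr = (\<lambda>f. farr G (farr F f))\<rparr>"

definition natural_iso ::
  "('o, 'm) category \<Rightarrow> ('p, 'k) category \<Rightarrow> ('o, 'm, 'p, 'k) cat_functor \<Rightarrow>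
   ('o, 'm, 'p, 'k) cat_functor \<Rightarrow> ('o \<Rightarrow> 'k) \<Rightarrow> bool" where
  "natural_iso C C' F G \<eta> \<longleftrightarrow>
     (\<forall>A \<in> Obj C. \<eta> A \<in> Hom C' (fobj F A) (fobj G A) \<and> iso_arr C' (\<eta> A)) \<and>
     (\<forall>A B. \<forall>f \<in> Hom C A B. \<eta> B \<cdot>\<^bsub>C'\<^esub> farr F f = farr G f \<cdot>\<^bsub>C'\<^esub> \<eta> A)"

definition is_equivalence ::
  "('o, 'm) category \<Rightarrow> ('p, 'k) category \<Rightarrow> ('o, 'm, 'p, 'k) cat_functor \<Rightarrow> bool" where
  "is_equivalence C C' F \<longleftrightarrow> is_functor C C' F \<and>
     (\<exists>G \<eta> \<epsilon>. is_functor C' C G \<and>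
        natural_iso C C id_functor (comp_functor G F) \<eta> \<and>
        natural_iso C' C' (comp_functor F G) id_functor \<epsilon>)"


section \<open>Additive categories\<close>

text \<open>An enrichment over abelian groups is a family of abelian group structures on the hom-sets
  for which composition is bilinear. The groups use the library's multiplicative notation:
  the group operation is the sum of morphisms and the unit is the zero morphism.\<close>

definition ab_enrichment :: "('o, 'm) category \<Rightarrow> ('o \<Rightarrow> 'o \<Rightarrow> 'm monoid) \<Rightarrow> bool" where
  "ab_enrichment C G \<longleftrightarrow>
     (\<forall>A \<in> Obj C. \<forall>B \<in> Obj C. carrier (G A B) = Hom C A B \<and> comm_group (G A B)) \<and>
     (\<forall>A \<in> Obj C. \<forall>B \<in> Obj C. \<forall>D \<in> Obj C.
        (\<forall>g \<in> Hom C B D. (\<lambda>f. g \<cdot>\<^bsub>C\<^esub> f) \<in> hom (G A B) (G A D)) \<and>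
        (\<forall>f \<in> Hom C A B. (\<lambda>g. g \<cdot>\<^bsub>C\<^esub> f) \<in> hom (G B D) (G A D)))"

definition zero_object :: "('o, 'm) category \<Rightarrow> 'o \<Rightarrow> bool" where
  "zero_object C Z \<longleftrightarrow> Z \<in> Obj C \<and>
     (\<forall>A \<in> Obj C. (\<exists>!f. f \<in> Hom C A Z) \<and> (\<exists>!f. f \<in> Hom C Z A))"

record ('o, 'm) biprod_data =
  sumobj :: 'o
  inj1 :: 'm
  inj2 :: 'm
  proj1 :: 'm
  proj2 :: 'm

definition is_biproduct ::
  "('o, 'm) category \<Rightarrow> ('o \<Rightarrow> 'o \<Rightarrow> 'm monoid) \<Rightarrow> 'o \<Rightarrow> 'o \<Rightarrow> ('o, 'm) biprod_data \<Rightarrow> bool"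
  where
  "is_biproduct C G A B S \<longleftrightarrow> sumobj S \<in> Obj C \<and>
     inj1 S \<in> Hom C A (sumobj S) \<and> inj2 S \<in> Hom C B (sumobj S) \<and>
     proj1 S \<in> Hom C (sumobj S) A \<and> proj2 S \<in> Hom C (sumobj S) B \<and>
     proj1 S \<cdot>\<^bsub>C\<^esub> inj1 S = Ide C A \<and> proj2 S \<cdot>\<^bsub>C\<^esub> inj2 S = Ide C B \<and>
     proj1 S \<cdot>\<^bsub>C\<^esub> inj2 S = \<one>\<^bsub>G B A\<^esub> \<and> proj2 S \<cdot>\<^bsub>C\<^esub> inj1 S = \<one>\<^bsub>G A B\<^esub> \<and>
     (inj1 S \<cdot>\<^bsub>C\<^esub> proj1 S) \<otimes>\<^bsub>G (sumobj S) (sumobj S)\<^esub> (inj2 S \<cdot>\<^bsub>C\<^esub> proj2 S) = Ide C (sumobj S)"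

definition additive_structure :: "('o, 'm) category \<Rightarrow> ('o \<Rightarrow> 'o \<Rightarrow> 'm monoid) \<Rightarrow> bool" where
  "additive_structure C G \<longleftrightarrow> ab_enrichment C G \<and> (\<exists>Z. zero_object C Z) \<and>
     (\<forall>A \<in> Obj C. \<forall>B \<in> Obj C. \<exists>S. is_biproduct C G A B S)"

definition additive_category :: "('o, 'm) category \<Rightarrow> bool" where
  "additive_category C \<longleftrightarrow> category C \<and> (\<exists>G. additive_structure C G)"

text \<open>Being additive is a property of a category: the enrichment is unique, as shown by
  \<open>additive_structure_unique\<close> below. So the choice in the next definition is immaterial.\<close>

definition hom_group :: "('o, 'm) category \<Rightarrow> 'o \<Rightarrow> 'o \<Rightarrow> 'm monoid" where
  "hom_group C = (SOME G. additive_structure C G)"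

lemma additive_structure_unit_unique:
  assumes "category C" "additive_structure C G" "additive_structure C H"
    and A: "A \<in> Obj C" and B: "B \<in> Obj C"
  shows "\<one>\<^bsub>G A B\<^esub> = \<one>\<^bsub>H A B\<^esub>"
proof -
  obtain Z where Z: "zero_object C Z" using assms by (auto simp: additive_structure_def)
  then have ZO: "Z \<in> Obj C" by (simp add: zero_object_def)
  obtain h where h: "h \<in> Hom C A Z" using Z A by (auto simp: zero_object_def)
  have *: "\<one>\<^bsub>K A B\<^esub> = \<one>\<^bsub>K Z B\<^esub> \<cdot>\<^bsub>C\<^esub> h \<and> \<one>\<^bsub>K Z B\<^esub> \<in> Hom C Z B"
    if K: "additive_structure C K" for K
  proof -
    have cg: "\<And>P Q. \<lbrakk>P \<in> Obj C; Q \<in> Obj C\<rbrakk> \<Longrightarrow> carrier (K P Q) = Hom C P Q \<and> comm_group (K P Q)"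
      and hm: "(\<lambda>g. g \<cdot>\<^bsub>C\<^esub> h) \<in> hom (K Z B) (K A B)"
      using K A B ZO h by (auto simp: additive_structure_def ab_enrichment_def)
    interpret K1: comm_group "K Z B" using cg ZO B by blast
    interpret K2: comm_group "K A B" using cg A B by blast
    have "\<one>\<^bsub>K Z B\<^esub> \<cdot>\<^bsub>C\<^esub> h = \<one>\<^bsub>K A B\<^esub>"
      using hom_one[OF hm K1.is_group K2.is_group] .
    then show ?thesis using cg ZO B K1.one_closed by auto
  qed
  have "\<one>\<^bsub>G Z B\<^esub> = \<one>\<^bsub>H Z B\<^esub>"
    using Z B *[OF assms(2)] *[OF assms(3)] by (auto simp: zero_object_def)
  then show ?thesis using * assms by metis
qed

lemma additive_structure_unique:
  fixes C :: "('o, 'm) category" (structure)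
  assumes C: "category C" and G: "additive_structure C G" and H: "additive_structure C H"
    and f: "f \<in> Hom C A B" and g: "g \<in> Hom C A B"
  shows "f \<otimes>\<^bsub>G A B\<^esub> g = f \<otimes>\<^bsub>H A B\<^esub> g"
proof -
  interpret category C by fact
  have A: "A \<in> Obj C" and B: "B \<in> Obj C" using f Dom_Obj Cod_Obj by (auto simp: Hom_def)
  obtain S where S: "is_biproduct C G A A S" using G A by (auto simp: additive_structure_def)
  let ?S = "sumobj S"
  let ?i = "inj1 S" and ?j = "inj2 S" and ?p = "proj1 S" and ?q = "proj2 S"
  have SO: "?S \<in> Obj C" and i: "?i \<in> Hom C A ?S" and j: "?j \<in> Hom C A ?S"
    and p: "?p \<in> Hom C ?S A" and q: "?q \<in> Hom C ?S A"
    and pi: "?p \<cdot> ?i = Ide C A" and qj: "?q \<cdot> ?j = Ide C A"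
    and pj: "?p \<cdot> ?j = \<one>\<^bsub>G A A\<^esub>" and qi: "?q \<cdot> ?i = \<one>\<^bsub>G A A\<^esub>"
    and ij: "(?i \<cdot> ?p) \<otimes>\<^bsub>G ?S ?S\<^esub> (?j \<cdot> ?q) = Ide C ?S"
    using S by (auto simp: is_biproduct_def)
  have car: "carrier (K P Q) = Hom C P Q" and cg: "comm_group (K P Q)"
    if "additive_structure C K" "P \<in> Obj C" "Q \<in> Obj C" for K P Q
    using that by (auto simp: additive_structure_def ab_enrichment_def)
  have cl: "a \<otimes>\<^bsub>K P Q\<^esub> b \<in> Hom C P Q"
    if "additive_structure C K" "P \<in> Obj C" "Q \<in> Obj C" "a \<in> Hom C P Q" "b \<in> Hom C P Q"
    for K P Q a b
  proof -
    interpret K: comm_group "K P Q" using cg that by blast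
    show ?thesis using K.m_closed car that by auto
  qed
  have lft: "c \<cdot> (a \<otimes>\<^bsub>K P Q\<^esub> b) = (c \<cdot> a) \<otimes>\<^bsub>K P R\<^esub> (c \<cdot> b)"
    if K: "additive_structure C K" and O: "P \<in> Obj C" "Q \<in> Obj C" "R \<in> Obj C"
      and a: "a \<in> Hom C P Q" "b \<in> Hom C P Q" and c: "c \<in> Hom C Q R" for K P Q R a b c
  proof -
    have "(\<lambda>x. c \<cdot> x) \<in> hom (K P Q) (K P R)"
      using K O c by (auto simp: additive_structure_def ab_enrichment_def)
    then show ?thesis using hom_mult[of "\<lambda>x. c \<cdot> x"] car[OF K] O a by metis
  qed
  have rgt: "(a \<otimes>\<^bsub>K Q R\<^esub> b) \<cdot> c = (a \<cdot> c) \<otimes>\<^bsub>K P R\<^esub> (b \<cdot> c)"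
    if K: "additive_structure C K" and O: "P \<in> Obj C" "Q \<in> Obj C" "R \<in> Obj C"
      and a: "a \<in> Hom C Q R" "b \<in> Hom C Q R" and c: "c \<in> Hom C P Q" for K P Q R a b c
  proof -
    have "(\<lambda>x. x \<cdot> c) \<in> hom (K Q R) (K P R)"
      using K O c by (auto simp: additive_structure_def ab_enrichment_def)
    then show ?thesis using hom_mult[of "\<lambda>x. x \<cdot> c"] car[OF K] O a by metis
  qed
  have unit: "a \<otimes>\<^bsub>K P Q\<^esub> \<one>\<^bsub>G P Q\<^esub> = a" "\<one>\<^bsub>G P Q\<^esub> \<otimes>\<^bsub>K P Q\<^esub> a = a"
    if K: "additive_structure C K" and O: "P \<in> Obj C" "Q \<in> Obj C" and a: "a \<in> Hom C P Q"
    for K P Q a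
  proof -
    interpret K: comm_group "K P Q" using cg that by blast
    have "\<one>\<^bsub>G P Q\<^esub> = \<one>\<^bsub>K P Q\<^esub>" using additive_structure_unit_unique[OF C G K] O by blast
    then show "a \<otimes>\<^bsub>K P Q\<^esub> \<one>\<^bsub>G P Q\<^esub> = a" "\<one>\<^bsub>G P Q\<^esub> \<otimes>\<^bsub>K P Q\<^esub> a = a" using a car[OF K] O by auto
  qed
  have zero_comp: "c \<cdot> \<one>\<^bsub>G P Q\<^esub> = \<one>\<^bsub>G P R\<^esub>"
    if O: "P \<in> Obj C" "Q \<in> Obj C" "R \<in> Obj C" and c: "c \<in> Hom C Q R" for P Q R c
  proof -
    interpret K1: comm_group "G P Q" using cg G O by blast
    interpret K2: comm_group "G P R" using cg G O by blast
    have "(\<lambda>x. c \<cdot> x) \<in> hom (G P Q) (G P R)"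
      using G O c by (auto simp: additive_structure_def ab_enrichment_def)
    then show ?thesis using hom_one K1.is_group K2.is_group by metis
  qed
  define x where "x = ?i \<otimes>\<^bsub>H A ?S\<^esub> ?j"
  have x: "x \<in> Hom C A ?S" unfolding x_def using cl[OF H A SO i j] .
  have IA: "Ide C A \<in> Hom C A A" using Ide_Hom A .
  have px: "?p \<cdot> x = Ide C A" and qx: "?q \<cdot> x = Ide C A"
    unfolding x_def
    using lft[OF H A SO A i j p] lft[OF H A SO A i j q] pi pj qi qj unit[OF H A A IA] by simp_all
  have "x = Ide C ?S \<cdot> x" using Ide_Comp[OF x] by simp
  also have "\<dots> = ((?i \<cdot> ?p) \<cdot> x) \<otimes>\<^bsub>G A ?S\<^esub> ((?j \<cdot> ?q) \<cdot> x)"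
    using rgt[OF G A SO SO Comp_Hom[OF p i] Comp_Hom[OF q j] x] ij by simp
  also have "\<dots> = ?i \<otimes>\<^bsub>G A ?S\<^esub> ?j"
    using Comp_assoc[OF x p i] Comp_assoc[OF x q j] px qx Comp_Ide[OF i] Comp_Ide[OF j] by simp
  finally have x_eq: "x = ?i \<otimes>\<^bsub>G A ?S\<^esub> ?j" .
  define c where "c = (f \<cdot> ?p) \<otimes>\<^bsub>G ?S B\<^esub> (g \<cdot> ?q)"
  have fp: "f \<cdot> ?p \<in> Hom C ?S B" and gq: "g \<cdot> ?q \<in> Hom C ?S B"
    using Comp_Hom p q f g by blast+
  have c: "c \<in> Hom C ?S B" unfolding c_def using cl[OF G SO B fp gq] .
  have ci: "c \<cdot> ?i = f"
    unfolding c_def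
    using rgt[OF G A SO B fp gq i] Comp_assoc[OF i p f] Comp_assoc[OF i q g] pi qi
      Comp_Ide[OF f] zero_comp[OF A A B g] unit[OF G A B f] by simp
  have cj: "c \<cdot> ?j = g"
    unfolding c_def
    using rgt[OF G A SO B fp gq j] Comp_assoc[OF j p f] Comp_assoc[OF j q g] pj qj
      Comp_Ide[OF g] zero_comp[OF A A B f] unit[OF G A B g] by simp
  have "f \<otimes>\<^bsub>G A B\<^esub> g = c \<cdot> x"
    using lft[OF G A SO B i j c] ci cj x_eq by simp
  also have "\<dots> = f \<otimes>\<^bsub>H A B\<^esub> g"
    using lft[OF H A SO B i j c] ci cj x_def by simp
  finally show ?thesis .
qed

definition zero_arr :: "('o, 'm) category \<Rightarrow> 'o \<Rightarrow> 'o \<Rightarrow> 'm" where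
  "zero_arr C A B = \<one>\<^bsub>hom_group C A B\<^esub>"

definition add_arr :: "('o, 'm) category \<Rightarrow> 'm \<Rightarrow> 'm \<Rightarrow> 'm" where
  "add_arr C f g = f \<otimes>\<^bsub>hom_group C (Dom C f) (Cod C f)\<^esub> g"

definition neg_arr :: "('o, 'm) category \<Rightarrow> 'm \<Rightarrow> 'm" where
  "neg_arr C f = inv\<^bsub>hom_group C (Dom C f) (Cod C f)\<^esub> f"

definition biprod :: "('o, 'm) category \<Rightarrow> 'o \<Rightarrow> 'o \<Rightarrow> ('o, 'm) biprod_data" where
  "biprod C A B = (SOME S. is_biproduct C (hom_group C) A B S)"

definition additive_functor ::
  "('o, 'm) category \<Rightarrow> ('p, 'k) category \<Rightarrow> ('o, 'm, 'p, 'k) cat_functor \<Rightarrow> bool" where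
  "additive_functor C C' F \<longleftrightarrow> is_functor C C' F \<and>
     (\<forall>A \<in> Obj C. \<forall>B \<in> Obj C.
        farr F \<in> hom (hom_group C A B) (hom_group C' (fobj F A) (fobj F B)))"

text \<open>The matrices \<open>(a b)\<^sup>T\<close>, \<open>(a b)\<close> and \<open>((a b) (a' b'))\<close> (by rows) of morphisms, where \<open>S\<close> is the
  biproduct from which, and \<open>T\<close> the biproduct to which, the morphism goes.\<close>

definition col_arr :: "('o, 'm) category \<Rightarrow> ('o, 'm) biprod_data \<Rightarrow> 'm \<Rightarrow> 'm \<Rightarrow> 'm" where
  "col_arr C T a b = add_arr C (inj1 T \<cdot>\<^bsub>C\<^esub> a) (inj2 T \<cdot>\<^bsub>C\<^esub> b)"

definition row_arr :: "('o, 'm) category \<Rightarrow> ('o, 'm) biprod_data \<Rightarrow> 'm \<Rightarrow> 'm \<Rightarrow> 'm" where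
  "row_arr C S a b = add_arr C (a \<cdot>\<^bsub>C\<^esub> proj1 S) (b \<cdot>\<^bsub>C\<^esub> proj2 S)"

definition mat_arr ::
  "('o, 'm) category \<Rightarrow> ('o, 'm) biprod_data \<Rightarrow> ('o, 'm) biprod_data \<Rightarrow>
   'm \<Rightarrow> 'm \<Rightarrow> 'm \<Rightarrow> 'm \<Rightarrow> 'm" where
  "mat_arr C S T a b a' b' = col_arr C T (row_arr C S a b) (row_arr C S a' b')"


section \<open>Complexes\<close>

text \<open>A sequence \<open>X 0 \<rightarrow> X 1 \<rightarrow> \<dots>\<close>, with \<open>diff X i\<close> going from \<open>obj X i\<close> to \<open>obj X (i + 1)\<close>. Only the
  entries in the relevant range of degrees carry information: \<open>cochain_complex C m\<close> looks at
  \<open>obj X 0, \<dots>, obj X (m + 1)\<close> and \<open>diff X 0, \<dots>, diff X m\<close>, and all other entries are arbitrary.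
  In particular, a complex is truncated on the right simply by lowering \<open>m\<close>.\<close>

record ('o, 'm) sequence =
  obj :: "nat \<Rightarrow> 'o"
  diff :: "nat \<Rightarrow> 'm"

definition composable_seq :: "('o, 'm) category \<Rightarrow> nat \<Rightarrow> ('o, 'm) sequence \<Rightarrow> bool" where
  "composable_seq C m X \<longleftrightarrow>
     (\<forall>i \<le> m + 1. obj X i \<in> Obj C) \<and> (\<forall>i \<le> m. diff X i \<in> Hom C (obj X i) (obj X (i + 1)))"

definition cochain_complex :: "('o, 'm) category \<Rightarrow> nat \<Rightarrow> ('o, 'm) sequence \<Rightarrow> bool" where
  "cochain_complex C m X \<longleftrightarrow> composable_seq C m X \<and>
     (\<forall>i < m. diff X (i + 1) \<cdot>\<^bsub>C\<^esub> diff X i = zero_arr C (obj X i) (obj X (i + 2)))"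

definition complex_mor ::
  "('o, 'm) category \<Rightarrow> nat \<Rightarrow> ('o, 'm) sequence \<Rightarrow> ('o, 'm) sequence \<Rightarrow> (nat \<Rightarrow> 'm) \<Rightarrow> bool"
  where
  "complex_mor C m X Y f \<longleftrightarrow> cochain_complex C m X \<and> cochain_complex C m Y \<and>
     (\<forall>i \<le> m + 1. f i \<in> Hom C (obj X i) (obj Y i)) \<and>
     (\<forall>i \<le> m. f (i + 1) \<cdot>\<^bsub>C\<^esub> diff X i = diff Y i \<cdot>\<^bsub>C\<^esub> f i)"

definition tail_seq :: "('o, 'm) sequence \<Rightarrow> ('o, 'm) sequence" where
  "tail_seq X = \<lparr>obj = (\<lambda>i. obj X (i + 1)), diff = (\<lambda>i. diff X (i + 1))\<rparr>"

definition map_seq ::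
  "('o, 'm, 'p, 'k) cat_functor \<Rightarrow> ('o, 'm) sequence \<Rightarrow> ('p, 'k) sequence" where
  "map_seq F X = \<lparr>obj = (\<lambda>i. fobj F (obj X i)), diff = (\<lambda>i. farr F (diff X i))\<rparr>"


section \<open>\<open>n\<close>-exact sequences, \<open>n\<close>-pullbacks and \<open>n\<close>-pushouts\<close>

text \<open>\<open>n_kernel n C X\<close>: \<open>(diff X 0, \<dots>, diff X (n - 1))\<close> is an \<open>n\<close>-kernel of \<open>diff X n\<close>.\<close>

definition n_kernel :: "nat \<Rightarrow> ('o, 'm) category \<Rightarrow> ('o, 'm) sequence \<Rightarrow> bool" where
  "n_kernel n C X \<longleftrightarrow> composable_seq C n X \<and>
     (\<forall>Z \<in> Obj C.
        {g \<in> Hom C Z (obj X 0). diff X 0 \<cdot>\<^bsub>C\<^esub> g = zero_arr C Z (obj X 1)}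
          = {zero_arr C Z (obj X 0)} \<and>
        (\<forall>i < n.
           {g \<in> Hom C Z (obj X (i + 1)). diff X (i + 1) \<cdot>\<^bsub>C\<^esub> g = zero_arr C Z (obj X (i + 2))}
             = (\<lambda>h. diff X i \<cdot>\<^bsub>C\<^esub> h) ` Hom C Z (obj X i)))"

text \<open>\<open>n_cokernel n C X\<close>: \<open>(diff X 1, \<dots>, diff X n)\<close> is an \<open>n\<close>-cokernel of \<open>diff X 0\<close>.\<close>

definition n_cokernel :: "nat \<Rightarrow> ('o, 'm) category \<Rightarrow> ('o, 'm) sequence \<Rightarrow> bool" where
  "n_cokernel n C X \<longleftrightarrow> composable_seq C n X \<and>
     (\<forall>Z \<in> Obj C.
        {g \<in> Hom C (obj X (n + 1)) Z. g \<cdot>\<^bsub>C\<^esub> diff X n = zero_arr C (obj X n) Z}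
          = {zero_arr C (obj X (n + 1)) Z} \<and>
        (\<forall>i < n.
           {g \<in> Hom C (obj X (i + 1)) Z. g \<cdot>\<^bsub>C\<^esub> diff X i = zero_arr C (obj X i) Z}
             = (\<lambda>h. h \<cdot>\<^bsub>C\<^esub> diff X (i + 1)) ` Hom C (obj X (i + 2)) Z))"

definition n_exact_seq :: "nat \<Rightarrow> ('o, 'm) category \<Rightarrow> ('o, 'm) sequence \<Rightarrow> bool" where
  "n_exact_seq n C X \<longleftrightarrow> cochain_complex C n X \<and> n_kernel n C X \<and> n_cokernel n C X"

text \<open>The mapping cone of a morphism \<open>f : X \<rightarrow> Y\<close> of complexes in degrees \<open>0, \<dots>, n\<close> lives in degrees
  \<open>-1, \<dots>, n\<close>; it is reindexed here to start in degree \<open>0\<close>, so \<open>diff i\<close> is the differential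
  of the cone leaving degree \<open>i - 1\<close>.\<close>

definition mapping_cone ::
  "nat \<Rightarrow> ('o, 'm) category \<Rightarrow> ('o, 'm) sequence \<Rightarrow> ('o, 'm) sequence \<Rightarrow> (nat \<Rightarrow> 'm) \<Rightarrow>
   ('o, 'm) sequence" where
  "mapping_cone n C X Y f =
     (let S = (\<lambda>i. biprod C (obj X i) (obj Y (i - 1))) in
      \<lparr>obj = (\<lambda>i. if i = 0 then obj X 0 else if i \<le> n then sumobj (S i) else obj Y n),
       diff = (\<lambda>i.
         if i = 0 then col_arr C (S 1) (neg_arr C (diff X 0)) (f 0)
         else if i < n then
           mat_arr C (S i) (S (i + 1))
             (neg_arr C (diff X i)) (zero_arr C (obj Y (i - 1)) (obj X (i + 1)))
             (f i)                  (diff Y (i - 1))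
         else row_arr C (S n) (f n) (diff Y (n - 1)))\<rparr>)"

definition n_pullback ::
  "nat \<Rightarrow> ('o, 'm) category \<Rightarrow> ('o, 'm) sequence \<Rightarrow> 'm \<Rightarrow> ('o, 'm) sequence \<Rightarrow> (nat \<Rightarrow> 'm) \<Rightarrow> bool"
  where
  "n_pullback n C X h Z g \<longleftrightarrow>
     complex_mor C (n - 1) Z X g \<and> g n = h \<and> n_kernel n C (mapping_cone n C Z X g)"

definition n_pushout ::
  "nat \<Rightarrow> ('o, 'm) category \<Rightarrow> ('o, 'm) sequence \<Rightarrow> 'm \<Rightarrow> ('o, 'm) sequence \<Rightarrow> (nat \<Rightarrow> 'm) \<Rightarrow> bool"
  where
  "n_pushout n C X h Y f \<longleftrightarrow>
     complex_mor C (n - 1) X Y f \<and> f 0 = h \<and> n_cokernel n C (mapping_cone n C X Y f)"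


section \<open>\<open>n\<close>-exact categories\<close>

definition weak_iso ::
  "nat \<Rightarrow> ('o, 'm) category \<Rightarrow> ('o, 'm) sequence \<Rightarrow> ('o, 'm) sequence \<Rightarrow> (nat \<Rightarrow> 'm) \<Rightarrow> bool"
  where
  "weak_iso n C X Y f \<longleftrightarrow> n_exact_seq n C X \<and> n_exact_seq n C Y \<and> complex_mor C n X Y f \<and>
     (\<exists>i \<le> n + 1. iso_arr C (f i) \<and> iso_arr C (f ((i + 1) mod (n + 2))))"

text \<open>Two sequences are weakly isomorphic if there is a weak isomorphism between them, in either
  direction.\<close>

definition weakly_isomorphic ::
  "nat \<Rightarrow> ('o, 'm) category \<Rightarrow> ('o, 'm) sequence \<Rightarrow> ('o, 'm) sequence \<Rightarrow> bool" where
  "weakly_isomorphic n C X Y \<longleftrightarrow> (\<exists>f. weak_iso n C X Y f) \<or> (\<exists>f. weak_iso n C Y X f)"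

definition admissible_mono ::
  "('o, 'm) sequence set \<Rightarrow> 'm \<Rightarrow> bool" where
  "admissible_mono \<X> a \<longleftrightarrow> (\<exists>X \<in> \<X>. a = diff X 0)"

definition admissible_epi ::
  "nat \<Rightarrow> ('o, 'm) sequence set \<Rightarrow> 'm \<Rightarrow> bool" where
  "admissible_epi n \<X> a \<longleftrightarrow> (\<exists>X \<in> \<X>. a = diff X n)"

text \<open>Sequences that agree in the relevant degrees are weakly isomorphic (by identities), so a class
  closed under weak isomorphisms does not depend on the irrelevant entries of its members.\<close>

locale n_exact_category =
  fixes n :: nat and C :: "('o, 'm) category" (structure) and \<X> :: "('o, 'm) sequence set"
  assumes additive: "additive_category C"
    and n_exact: "X \<in> \<X> \<Longrightarrow> n_exact_seq n C X"
    and weak_iso_closed: "\<lbrakk>X \<in> \<X>; weakly_isomorphic n C X Y\<rbrakk> \<Longrightarrow> Y \<in> \<X>"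
    and E0: "zero_object C Z \<Longrightarrow> \<lparr>obj = (\<lambda>_. Z), diff = (\<lambda>_. Ide C Z)\<rparr> \<in> \<X>"
    and E1: "\<lbrakk>admissible_mono \<X> a; admissible_mono \<X> b; Cod C a = Dom C b\<rbrakk>
              \<Longrightarrow> admissible_mono \<X> (b \<cdot> a)"
    and E1_op: "\<lbrakk>admissible_epi n \<X> a; admissible_epi n \<X> b; Cod C a = Dom C b\<rbrakk>
              \<Longrightarrow> admissible_epi n \<X> (b \<cdot> a)"
    and E2: "\<lbrakk>X \<in> \<X>; h \<in> Hom C (obj X 0) B\<rbrakk>
              \<Longrightarrow> \<exists>Y f. n_pushout n C X h Y f \<and> admissible_mono \<X> (diff Y 0)"
    and E2_op: "\<lbrakk>X \<in> \<X>; h \<in> Hom C B (obj X (n + 1))\<rbrakk>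
              \<Longrightarrow> \<exists>Z g. n_pullback n C (tail_seq X) h Z g \<and> admissible_epi n \<X> (diff Z (n - 1))"

definition n_exact_functor ::
  "nat \<Rightarrow> ('o, 'm) category \<Rightarrow> ('o, 'm) sequence set \<Rightarrow> ('p, 'k) category \<Rightarrow>
   ('p, 'k) sequence set \<Rightarrow> ('o, 'm, 'p, 'k) cat_functor \<Rightarrow> bool" where
  "n_exact_functor n C \<X> C' \<X>' F \<longleftrightarrow>
     n_exact_category n C \<X> \<and> n_exact_category n C' \<X>' \<and> additive_functor C C' F \<and>
     (\<forall>X \<in> \<X>. map_seq F X \<in> \<X>')"

definition n_exact_equivalence ::
  "nat \<Rightarrow> ('o, 'm) category \<Rightarrow> ('o, 'm) sequence set \<Rightarrow> ('p, 'k) category \<Rightarrow>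
   ('p, 'k) sequence set \<Rightarrow> ('o, 'm, 'p, 'k) cat_functor \<Rightarrow> bool" where
  "n_exact_equivalence n C \<X> C' \<X>' F \<longleftrightarrow>
     n_exact_functor n C \<X> C' \<X>' F \<and> is_equivalence C C' F"

end

theory Submission
  imports Defs
begin

text \<open>Let \<open>G\<close> be a quasi-inverse of \<open>F\<close>. Pulling the group structures on hom-sets back along \<open>G\<close>
  shows that \<open>C'\<close> is additive, and since the enrichment is unique, both \<open>F\<close> and \<open>G\<close> are additive.
  Exactness at a test object \<open>Z\<close> only involves hom-sets, so full faithfulness and essential
  surjectivity carry \<open>n\<close>-kernels and \<open>n\<close>-cokernels over to any sequence isomorphic to the image
  of the original one; mapping cones are such images up to the choice of biproducts.
  The key point is that \<open>Y\<close> lies in \<open>\<X>'\<close> iff \<open>G Y\<close> lies in \<open>\<X>\<close>: this makes \<open>\<X>'\<close> closed under weak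
  isomorphisms (which is not clear from its definition by a single weak isomorphism), and
  reduces each axiom for \<open>\<X>'\<close> to the corresponding one for \<open>\<X>\<close>.\<close>

section \<open>Isomorphisms\<close>

text \<open>Transport is proved for any fully faithful, essentially surjective functor, with no
  quasi-inverse named, so that the same lemmas serve \<open>F\<close>, \<open>G\<close> and the
  identity functor. The recurring obstacle is that several notions are literal where an equivalence
  yields only isomorphisms. Zero morphisms, sums and biproducts of the two categories come from
  unrelated choices; an admissible monomorphism must equal some \<open>diff X 0\<close>; an
  n-pushout must have exactly the given arrow in degree 0. So what is constructed in
  \<open>C\<close> and mapped by \<open>F\<close> is corrected afterwards by isomorphisms:
  components of \<open>F G \<rightarrow> 1\<close>, and identities where nothing is prescribed. A
  chain of weak isomorphisms is not evidently a single one, since the pairs of adjacent isomorphisms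
  may sit in different degrees and the directions may alternate. In \<open>C\<close> a chain is
  harmless because \<X> is closed under each step; on the way back, the single weak isomorphism
  required is the genuine isomorphism \<open>F (G Y) \<rightarrow> Y\<close>.\<close>

definition inv_arr :: "('o, 'm) category \<Rightarrow> 'm \<Rightarrow> 'm" where
  "inv_arr C f = (SOME g. g \<in> Hom C (Cod C f) (Dom C f) \<and>
     g \<cdot>\<^bsub>C\<^esub> f = Ide C (Dom C f) \<and> f \<cdot>\<^bsub>C\<^esub> g = Ide C (Cod C f))"

text \<open>The category axioms mention a middle object that does not occur in the composite.
  Restated through \<open>Arr\<close>, \<open>Dom\<close> and \<open>Cod\<close> they become
  conditional rewrite rules whose side conditions simplification can settle; hence the constant
  unfolding of \<open>Hom\<close>.\<close>

lemma in_Hom: "f \<in> Hom C A B \<longleftrightarrow> f \<in> Arr C \<and> Dom C f = A \<and> Cod C f = B"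
  by (simp add: Hom_def)

context category
begin

lemma Ide_arr [simp]:
  assumes "A \<in> Obj C"
  shows "Ide C A \<in> Arr C" "Dom C (Ide C A) = A" "Cod C (Ide C A) = A"
  using Ide_Hom[OF assms] by (simp_all add: in_Hom)

lemma comp_arr [simp]:
  assumes "f \<in> Arr C" "g \<in> Arr C" "Cod C f = Dom C g"
  shows "g \<cdot> f \<in> Arr C" "Dom C (g \<cdot> f) = Dom C f" "Cod C (g \<cdot> f) = Cod C g"
  using Comp_Hom[of f "Dom C f" "Cod C f" g "Cod C g"] assms by (simp_all add: in_Hom)

lemma comp_assoc [simp]:
  assumes "f \<in> Arr C" "g \<in> Arr C" "h \<in> Arr C" "Cod C f = Dom C g" "Cod C g = Dom C h"
  shows "(h \<cdot> g) \<cdot> f = h \<cdot> (g \<cdot> f)"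
  using Comp_assoc[of f "Dom C f" "Cod C f" g "Cod C g" h "Cod C h"] assms by (simp add: in_Hom)

lemma comp_Ide [simp]: "\<lbrakk>f \<in> Arr C; Dom C f = A\<rbrakk> \<Longrightarrow> f \<cdot> Ide C A = f"
  using Comp_Ide[of f A "Cod C f"] by (simp add: in_Hom)

lemma Ide_comp [simp]: "\<lbrakk>f \<in> Arr C; Cod C f = A\<rbrakk> \<Longrightarrow> Ide C A \<cdot> f = f"
  using Ide_Comp[of f "Dom C f" A] by (simp add: in_Hom)

lemma Dom_Cod_Obj [simp]: "f \<in> Arr C \<Longrightarrow> Dom C f \<in> Obj C" "f \<in> Arr C \<Longrightarrow> Cod C f \<in> Obj C"
  by (rule Dom_Obj Cod_Obj, assumption)+

lemma iso_arr_Arr: "iso_arr C f \<Longrightarrow> f \<in> Arr C"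
  by (simp add: iso_arr_def)

lemma iso_arrI:
  assumes "f \<in> Arr C" "g \<in> Arr C" "Dom C g = Cod C f" "Cod C g = Dom C f"
    and "g \<cdot> f = Ide C (Dom C f)" "f \<cdot> g = Ide C (Cod C f)"
  shows "iso_arr C f"
  using assms by (auto simp: iso_arr_def in_Hom)

lemma inv_arr_props:
  assumes "iso_arr C f"
  shows inv_arr_Arr [simp]: "inv_arr C f \<in> Arr C"
    and Dom_inv_arr [simp]: "Dom C (inv_arr C f) = Cod C f"
    and Cod_inv_arr [simp]: "Cod C (inv_arr C f) = Dom C f"
    and inv_arr_comp [simp]: "inv_arr C f \<cdot> f = Ide C (Dom C f)"
    and comp_inv_arr [simp]: "f \<cdot> inv_arr C f = Ide C (Cod C f)"
proof -
  have "\<exists>g. g \<in> Hom C (Cod C f) (Dom C f) \<and>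
     g \<cdot> f = Ide C (Dom C f) \<and> f \<cdot> g = Ide C (Cod C f)"
    using assms by (auto simp: iso_arr_def)
  from someI_ex[OF this, folded inv_arr_def]
  show "inv_arr C f \<in> Arr C" "Dom C (inv_arr C f) = Cod C f" "Cod C (inv_arr C f) = Dom C f"
    "inv_arr C f \<cdot> f = Ide C (Dom C f)" "f \<cdot> inv_arr C f = Ide C (Cod C f)"
    by (simp_all add: in_Hom)
qed

lemma inv_arr_cancel [simp]:
  assumes f: "iso_arr C f" and h: "h \<in> Arr C"
  shows "Cod C h = Dom C f \<Longrightarrow> inv_arr C f \<cdot> (f \<cdot> h) = h"
    and "Cod C h = Cod C f \<Longrightarrow> f \<cdot> (inv_arr C f \<cdot> h) = h"
proof -
  note [simp] = f h iso_arr_Arr[OF f]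
  show "inv_arr C f \<cdot> (f \<cdot> h) = h" if "Cod C h = Dom C f"
    using that by (simp flip: comp_assoc)
  show "f \<cdot> (inv_arr C f \<cdot> h) = h" if "Cod C h = Cod C f"
    using that by (simp flip: comp_assoc)
qed

lemma iso_arr_inv [simp]: "iso_arr C f \<Longrightarrow> iso_arr C (inv_arr C f)"
  by (rule iso_arrI[of _ f]) (simp_all add: iso_arr_Arr)

lemma iso_arr_Ide [simp]: "A \<in> Obj C \<Longrightarrow> iso_arr C (Ide C A)"
  by (rule iso_arrI[of _ "Ide C A"]) simp_all

text \<open>Equations containing inverses are often checked after precomposition with an
  isomorphism, where the inverses cancel and commuting squares apply. This is the cancellation that
  ends such an argument.\<close>

lemma iso_arr_epi:
  assumes e: "iso_arr C e" and xy: "x \<in> Arr C" "y \<in> Arr C" "Dom C x = Cod C e" "Dom C y = Cod C e"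
    and eq: "x \<cdot> e = y \<cdot> e"
  shows "x = y"
proof -
  have "(x \<cdot> e) \<cdot> inv_arr C e = (y \<cdot> e) \<cdot> inv_arr C e" using eq by simp
  then show ?thesis using e xy iso_arr_Arr[OF e] by simp
qed

end

section \<open>Functors\<close>

locale functor_between = C: category C + D: category D
  for C :: "('o, 'm) category" and D :: "('p, 'k) category" +
  fixes F :: "('o, 'm, 'p, 'k) cat_functor"
  assumes is_functor: "is_functor C D F"
begin

lemma fobj_Obj [simp]: "A \<in> Obj C \<Longrightarrow> fobj F A \<in> Obj D"
  using is_functor by (simp add: is_functor_def)

lemma farr_Arr [simp]:
  assumes "f \<in> Arr C"
  shows "farr F f \<in> Arr D" "Dom D (farr F f) = fobj F (Dom C f)"
    "Cod D (farr F f) = fobj F (Cod C f)"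
  using is_functor assms unfolding is_functor_def Ball_def in_Hom by blast+

lemma farr_Ide [simp]: "A \<in> Obj C \<Longrightarrow> farr F (Ide C A) = Ide D (fobj F A)"
  using is_functor by (simp add: is_functor_def)

lemma farr_comp:
  "\<lbrakk>f \<in> Arr C; g \<in> Arr C; Cod C f = Dom C g\<rbrakk>
    \<Longrightarrow> farr F (g \<cdot>\<^bsub>C\<^esub> f) = farr F g \<cdot>\<^bsub>D\<^esub> farr F f"
  using is_functor unfolding is_functor_def Ball_def in_Hom by blast

lemma farr_iso [simp]: "iso_arr C f \<Longrightarrow> iso_arr D (farr F f)"
  by (rule D.iso_arrI[of _ "farr F (inv_arr C f)"])
    (simp_all add: C.iso_arr_Arr flip: farr_comp)

end

locale fully_faithful_ess_surj = functor_between C D F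
  for C :: "('o, 'm) category" and D :: "('p, 'k) category"
    and F :: "('o, 'm, 'p, 'k) cat_functor" +
  assumes farr_bij:
      "\<lbrakk>A \<in> Obj C; B \<in> Obj C\<rbrakk> \<Longrightarrow> bij_betw (farr F) (Hom C A B) (Hom D (fobj F A) (fobj F B))"
    and ess_surj: "Z \<in> Obj D \<Longrightarrow> \<exists>W \<in> Obj C. \<exists>\<psi> \<in> Hom D (fobj F W) Z. iso_arr D \<psi>"
begin

lemma farr_eqD:
  assumes "f \<in> Arr C" "g \<in> Arr C" "Dom C f = Dom C g" "Cod C f = Cod C g" "farr F f = farr F g"
  shows "f = g"
  using farr_bij[of "Dom C f" "Cod C f"] assms
  by (auto simp: bij_betw_def in_Hom dest: inj_onD)

end

text \<open>For the identity functor, transport becomes invariance under isomorphism of sequences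
  within one category; \<open>n_exact_seq_iso\<close> is obtained this way.\<close>

lemma fully_faithful_ess_surj_id: "category C \<Longrightarrow> fully_faithful_ess_surj C C id_functor"
  unfolding fully_faithful_ess_surj_def fully_faithful_ess_surj_axioms_def functor_between_def
    functor_between_axioms_def
  by (auto simp: is_functor_def id_functor_def bij_betw_def
      intro: category.iso_arr_Ide category.Ide_Hom)

lemma natural_isoD:
  assumes "natural_iso C D F G \<eta>"
  shows "A \<in> Obj C \<Longrightarrow> \<eta> A \<in> Arr D" "A \<in> Obj C \<Longrightarrow> Dom D (\<eta> A) = fobj F A"
    "A \<in> Obj C \<Longrightarrow> Cod D (\<eta> A) = fobj G A" "A \<in> Obj C \<Longrightarrow> iso_arr D (\<eta> A)"
    "f \<in> Arr C \<Longrightarrow> \<eta> (Cod C f) \<cdot>\<^bsub>D\<^esub> farr F f = farr G f \<cdot>\<^bsub>D\<^esub> \<eta> (Dom C f)"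
  using assms unfolding natural_iso_def Ball_def in_Hom by blast+

lemma natural_iso_inverse:
  assumes "category C" "category D" "is_functor C D F" "is_functor C D G"
    and \<eta>: "natural_iso C D F G \<eta>"
  shows "natural_iso C D G F (\<lambda>A. inv_arr D (\<eta> A))"
proof -
  interpret F: functor_between C D F by (simp add: functor_between_def functor_between_axioms_def assms)
  interpret G: functor_between C D G by (simp add: functor_between_def functor_between_axioms_def assms)
  note [simp] = natural_isoD(1-4)[OF \<eta>]
  have "inv_arr D (\<eta> (Cod C f)) \<cdot>\<^bsub>D\<^esub> farr G f = farr F f \<cdot>\<^bsub>D\<^esub> inv_arr D (\<eta> (Dom C f))"
    if f: "f \<in> Arr C" for f
  proof (rule F.D.iso_arr_epi[of "\<eta> (Dom C f)"])
    show "(inv_arr D (\<eta> (Cod C f)) \<cdot>\<^bsub>D\<^esub> farr G f) \<cdot>\<^bsub>D\<^esub> \<eta> (Dom C f) =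
      (farr F f \<cdot>\<^bsub>D\<^esub> inv_arr D (\<eta> (Dom C f))) \<cdot>\<^bsub>D\<^esub> \<eta> (Dom C f)"
      using f by (simp flip: natural_isoD(5)[OF \<eta>])
  qed (use f in simp_all)
  then show ?thesis by (auto simp: natural_iso_def in_Hom)
qed

text \<open>The definition of equivalence fixes the directions \<open>1 \<rightarrow> G F\<close>
  and \<open>F G \<rightarrow> 1\<close>. Exchanging the roles of \<open>F\<close> and
  \<open>G\<close> reverses both.\<close>

lemma equivalence_inverse:
  assumes "category C" "category D" "is_functor C D F" "is_functor D C G"
    and \<eta>: "natural_iso C C id_functor (comp_functor G F) \<eta>"
    and \<epsilon>: "natural_iso D D (comp_functor F G) id_functor \<epsilon>"
  shows "natural_iso C C (comp_functor G F) id_functor (\<lambda>A. inv_arr C (\<eta> A))"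
    and "natural_iso D D id_functor (comp_functor F G) (\<lambda>A. inv_arr D (\<epsilon> A))"
proof -
  interpret F: functor_between C D F by (simp add: functor_between_def functor_between_axioms_def assms)
  interpret G: functor_between D C G by (simp add: functor_between_def functor_between_axioms_def assms)
  have "is_functor C C id_functor" "is_functor D D id_functor"
    "is_functor C C (comp_functor G F)" "is_functor D D (comp_functor F G)"
    by (auto simp: is_functor_def id_functor_def comp_functor_def in_Hom F.farr_comp G.farr_comp)
  then show "natural_iso C C (comp_functor G F) id_functor (\<lambda>A. inv_arr C (\<eta> A))"
    and "natural_iso D D id_functor (comp_functor F G) (\<lambda>A. inv_arr D (\<epsilon> A))"
    using natural_iso_inverse assms by blast+
qed

text \<open>Faithfulness is the naturality of \<open>\<eta>\<close> (\<open>f\<close> is recovered from \<open>G F f\<close>), and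
  fullness comes from the faithfulness of \<open>G\<close>.\<close>

lemma equivalence_imp_fully_faithful_ess_surj:
  assumes C: "category C" and D: "category D" and F: "is_functor C D F" and G: "is_functor D C G"
    and \<eta>: "natural_iso C C id_functor (comp_functor G F) \<eta>"
    and \<epsilon>: "natural_iso D D (comp_functor F G) id_functor \<epsilon>"
  shows "fully_faithful_ess_surj C D F"
proof -
  interpret F: functor_between C D F by (simp add: functor_between_def functor_between_axioms_def assms)
  interpret G: functor_between D C G by (simp add: functor_between_def functor_between_axioms_def assms)
  note eta[simp] = natural_isoD[OF \<eta>, simplified id_functor_def comp_functor_def, simplified]
  note eps = natural_isoD[OF \<epsilon>, simplified id_functor_def comp_functor_def, simplified]
  note [simp] = eps(1-4)
  have G_inj: "f = g" if "f \<in> Arr D" "g \<in> Arr D" "Dom D f = Dom D g" "Cod D f = Cod D g"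
    "farr G f = farr G g" for f g
    using eps(5)[OF that(1)] eps(5)[OF that(2)] that
    by (intro F.D.iso_arr_epi[of "\<epsilon> (Dom D f)" f g]) simp_all
  have F_inj: "f = g" if fg: "f \<in> Arr C" "g \<in> Arr C" "Dom C f = Dom C g" "Cod C f = Cod C g"
    "farr F f = farr F g" for f g
  proof -
    have "\<eta> (Cod C f) \<cdot>\<^bsub>C\<^esub> f = \<eta> (Cod C f) \<cdot>\<^bsub>C\<^esub> g"
      using eta(5)[OF fg(1)] eta(5)[OF fg(2)] fg by simp
    then have "inv_arr C (\<eta> (Cod C f)) \<cdot>\<^bsub>C\<^esub> (\<eta> (Cod C f) \<cdot>\<^bsub>C\<^esub> f) =
      inv_arr C (\<eta> (Cod C f)) \<cdot>\<^bsub>C\<^esub> (\<eta> (Cod C f) \<cdot>\<^bsub>C\<^esub> g)" by simp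
    \<comment> \<open>Rewriting by naturality would move \<open>\<eta>\<close> past \<open>f\<close>
      again and hide the cancellation with its inverse.\<close>
    then show ?thesis using fg by (simp del: eta(5))
  qed
  have F_full: "k \<in> farr F ` Hom C A B"
    if A: "A \<in> Obj C" "B \<in> Obj C" and k: "k \<in> Hom D (fobj F A) (fobj F B)" for A B k
  proof -
    note k' = k[unfolded in_Hom]
    \<comment> \<open>Naturality of \<open>\<eta>\<close> leaves no other candidate:
      \<open>farr F f = k\<close> forces
      \<open>\<eta> B \<cdot> f = farr G k \<cdot> \<eta> A\<close>.\<close>
    define f where "f = inv_arr C (\<eta> B) \<cdot>\<^bsub>C\<^esub> (farr G k \<cdot>\<^bsub>C\<^esub> \<eta> A)"
    have f: "f \<in> Arr C" "Dom C f = A" "Cod C f = B"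
      and \<eta>f: "\<eta> B \<cdot>\<^bsub>C\<^esub> f = farr G k \<cdot>\<^bsub>C\<^esub> \<eta> A"
      unfolding f_def using A k' by (simp_all del: eta(5))
    have "farr G k = farr G (farr F f)"
    proof (rule F.C.iso_arr_epi[of "\<eta> A"])
      show "farr G k \<cdot>\<^bsub>C\<^esub> \<eta> A = farr G (farr F f) \<cdot>\<^bsub>C\<^esub> \<eta> A"
        using eta(5)[OF f(1)] unfolding f \<eta>f .
    qed (use A k' f in simp_all)
    then have "k = farr F f"
      using A k' f by (intro G_inj) simp_all
    then show ?thesis using f by (auto simp: in_Hom)
  qed
  have "bij_betw (farr F) (Hom C A B) (Hom D (fobj F A) (fobj F B))"
    if "A \<in> Obj C" "B \<in> Obj C" for A B
    using F_full[OF that] F_inj by (auto simp: bij_betw_def inj_on_def in_Hom)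
  moreover have "\<exists>W \<in> Obj C. \<exists>\<psi> \<in> Hom D (fobj F W) Z. iso_arr D \<psi>" if "Z \<in> Obj D" for Z
    using that by (intro bexI[of _ "fobj G Z"] bexI[of _ "\<epsilon> Z"]) (simp_all add: in_Hom)
  ultimately show ?thesis by unfold_locales auto
qed

section \<open>Additive categories\<close>

locale add_category = category +
  assumes additive: "additive_category C"
begin

lemma hom_group_additive: "additive_structure C (hom_group C)"
  using additive unfolding additive_category_def hom_group_def by (simp add: some_eq_ex)

lemma
  assumes "A \<in> Obj C" "B \<in> Obj C"
  shows carrier_hom_group: "carrier (hom_group C A B) = Hom C A B"
    and comm_group_hom_group: "comm_group (hom_group C A B)"
  using hom_group_additive assms by (auto simp: additive_structure_def ab_enrichment_def)

lemma
  assumes "A \<in> Obj C" "B \<in> Obj C" "D \<in> Obj C"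
  shows comp_hom: "g \<in> Hom C B D \<Longrightarrow> (\<lambda>f. g \<cdot> f) \<in> hom (hom_group C A B) (hom_group C A D)"
    and hom_comp: "f \<in> Hom C A B \<Longrightarrow> (\<lambda>g. g \<cdot> f) \<in> hom (hom_group C B D) (hom_group C A D)"
  using hom_group_additive assms by (auto simp: additive_structure_def ab_enrichment_def)

lemma zero_arr_props [simp]:
  assumes "A \<in> Obj C" "B \<in> Obj C"
  shows "zero_arr C A B \<in> Arr C" "Dom C (zero_arr C A B) = A" "Cod C (zero_arr C A B) = B"
proof -
  interpret comm_group "hom_group C A B" using assms by (rule comm_group_hom_group)
  have "zero_arr C A B \<in> Hom C A B"
    using one_closed carrier_hom_group[OF assms] by (simp add: zero_arr_def)
  then show "zero_arr C A B \<in> Arr C" "Dom C (zero_arr C A B) = A" "Cod C (zero_arr C A B) = B"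
    by (simp_all add: in_Hom)
qed

lemma add_arr_props [simp]:
  assumes "f \<in> Arr C" "g \<in> Arr C" "Dom C g = Dom C f" "Cod C g = Cod C f"
  shows "add_arr C f g \<in> Arr C" "Dom C (add_arr C f g) = Dom C f" "Cod C (add_arr C f g) = Cod C f"
proof -
  interpret comm_group "hom_group C (Dom C f) (Cod C f)"
    using assms by (intro comm_group_hom_group) simp_all
  have "add_arr C f g \<in> Hom C (Dom C f) (Cod C f)"
    using m_closed[of f g] carrier_hom_group[of "Dom C f" "Cod C f"] assms
    by (simp add: add_arr_def in_Hom)
  then show "add_arr C f g \<in> Arr C" "Dom C (add_arr C f g) = Dom C f"
    "Cod C (add_arr C f g) = Cod C f"
    by (simp_all add: in_Hom)
qed

lemma neg_arr_props [simp]: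
  assumes "f \<in> Arr C"
  shows "neg_arr C f \<in> Arr C" "Dom C (neg_arr C f) = Dom C f" "Cod C (neg_arr C f) = Cod C f"
proof -
  interpret comm_group "hom_group C (Dom C f) (Cod C f)"
    using assms by (intro comm_group_hom_group) simp_all
  have "neg_arr C f \<in> Hom C (Dom C f) (Cod C f)"
    using inv_closed[of f] carrier_hom_group[of "Dom C f" "Cod C f"] assms
    by (simp add: neg_arr_def in_Hom)
  then show "neg_arr C f \<in> Arr C" "Dom C (neg_arr C f) = Dom C f"
    "Cod C (neg_arr C f) = Cod C f"
    by (simp_all add: in_Hom)
qed

lemma add_zero [simp]:
  assumes "f \<in> Arr C"
  shows "Dom C f = A \<Longrightarrow> Cod C f = B \<Longrightarrow> add_arr C f (zero_arr C A B) = f"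
    and "Dom C f = A \<Longrightarrow> Cod C f = B \<Longrightarrow> add_arr C (zero_arr C A B) f = f"
    and "add_arr C f (neg_arr C f) = zero_arr C (Dom C f) (Cod C f)"
proof -
  interpret comm_group "hom_group C (Dom C f) (Cod C f)"
    using assms by (intro comm_group_hom_group) simp_all
  have f: "f \<in> carrier (hom_group C (Dom C f) (Cod C f))"
    using carrier_hom_group[of "Dom C f" "Cod C f"] assms by (simp add: in_Hom)
  show "Dom C f = A \<Longrightarrow> Cod C f = B \<Longrightarrow> add_arr C f (zero_arr C A B) = f"
    "Dom C f = A \<Longrightarrow> Cod C f = B \<Longrightarrow> add_arr C (zero_arr C A B) f = f"
    "add_arr C f (neg_arr C f) = zero_arr C (Dom C f) (Cod C f)"
    using f assms zero_arr_props[of A B] by (auto simp: add_arr_def zero_arr_def neg_arr_def)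
qed

lemma
  assumes "f \<in> Arr C" "g \<in> Arr C" "Dom C g = Dom C f" "Cod C g = Cod C f"
  shows add_commute: "add_arr C f g = add_arr C g f"
    and add_assoc: "\<lbrakk>h \<in> Arr C; Dom C h = Dom C f; Cod C h = Cod C f\<rbrakk>
      \<Longrightarrow> add_arr C (add_arr C f g) h = add_arr C f (add_arr C g h)"
proof -
  interpret comm_group "hom_group C (Dom C f) (Cod C f)"
    using assms by (intro comm_group_hom_group) simp_all
  note car = carrier_hom_group[of "Dom C f" "Cod C f"]
  show "add_arr C f g = add_arr C g f"
    using m_comm[of f g] car assms by (simp add: add_arr_def in_Hom)
  show "add_arr C (add_arr C f g) h = add_arr C f (add_arr C g h)"
    if "h \<in> Arr C" "Dom C h = Dom C f" "Cod C h = Cod C f"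
    using m_assoc[of f g h] car assms that add_arr_props[of f g]
    by (simp add: add_arr_def in_Hom)
qed

text \<open>Whatever respects sums and zero morphisms respects negatives too: this is how negation
  is moved through composition and, later, through functors.\<close>

lemma neg_unique:
  assumes "f \<in> Arr C" "g \<in> Arr C" "Dom C g = Dom C f" "Cod C g = Cod C f"
    and "add_arr C f g = zero_arr C (Dom C f) (Cod C f)"
  shows "g = neg_arr C f"
proof -
  interpret comm_group "hom_group C (Dom C f) (Cod C f)"
    using assms by (intro comm_group_hom_group) simp_all
  have "f \<in> carrier (hom_group C (Dom C f) (Cod C f))"
    "g \<in> carrier (hom_group C (Dom C f) (Cod C f))"
    using carrier_hom_group[of "Dom C f" "Cod C f"] assms by (simp_all add: in_Hom)
  then show ?thesis
    using assms(5) inv_equality[of g f] m_comm by (simp add: add_arr_def zero_arr_def neg_arr_def)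
qed

lemma comp_add:
  assumes "f \<in> Arr C" "g \<in> Arr C" "h \<in> Arr C" "Dom C g = Dom C f" "Cod C g = Cod C f"
    "Cod C f = Dom C h"
  shows "h \<cdot> add_arr C f g = add_arr C (h \<cdot> f) (h \<cdot> g)"
  using hom_mult[OF comp_hom[of "Dom C f" "Cod C f" "Cod C h" h], of f g]
    carrier_hom_group[of "Dom C f" "Cod C f"] assms
  by (simp add: in_Hom add_arr_def)

lemma add_comp:
  assumes "f \<in> Arr C" "g \<in> Arr C" "h \<in> Arr C" "Dom C g = Dom C f" "Cod C g = Cod C f"
    "Cod C h = Dom C f"
  shows "add_arr C f g \<cdot> h = add_arr C (f \<cdot> h) (g \<cdot> h)"
  using hom_mult[OF hom_comp[of "Dom C h" "Dom C f" "Cod C f" h], of f g]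
    carrier_hom_group[of "Dom C f" "Cod C f"] assms
  by (simp add: in_Hom add_arr_def)

lemma comp_zero [simp]:
  assumes "h \<in> Arr C" "A \<in> Obj C" "Dom C h = B"
  shows "h \<cdot> zero_arr C A B = zero_arr C A (Cod C h)"
proof -
  have B: "B \<in> Obj C" using assms by auto
  interpret K1: comm_group "hom_group C A B" using assms B by (intro comm_group_hom_group)
  interpret K2: comm_group "hom_group C A (Cod C h)" using assms by (intro comm_group_hom_group) simp_all
  show ?thesis
    using hom_one[OF comp_hom[of A B "Cod C h" h] K1.is_group K2.is_group] assms B
    by (simp add: in_Hom zero_arr_def)
qed

lemma zero_comp [simp]:
  assumes "h \<in> Arr C" "B \<in> Obj C" "Cod C h = A"
  shows "zero_arr C A B \<cdot> h = zero_arr C (Dom C h) B"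
proof -
  have A: "A \<in> Obj C" using assms by auto
  interpret K1: comm_group "hom_group C A B" using assms A by (intro comm_group_hom_group)
  interpret K2: comm_group "hom_group C (Dom C h) B" using assms by (intro comm_group_hom_group) simp_all
  show ?thesis
    using hom_one[OF hom_comp[of "Dom C h" A B h] K1.is_group K2.is_group] assms A
    by (simp add: in_Hom zero_arr_def)
qed

lemma comp_neg:
  assumes "f \<in> Arr C" "h \<in> Arr C" "Cod C f = Dom C h"
  shows "h \<cdot> neg_arr C f = neg_arr C (h \<cdot> f)"
  using assms by (intro neg_unique) (simp_all flip: comp_add)

lemma neg_comp:
  assumes "f \<in> Arr C" "h \<in> Arr C" "Cod C h = Dom C f"
  shows "neg_arr C f \<cdot> h = neg_arr C (f \<cdot> h)"
  using assms by (intro neg_unique) (simp_all flip: add_comp)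

end

section \<open>Equivalences transport additive structures\<close>

lemma zero_object_iso:
  fixes C :: "('o, 'm) category" (structure)
  assumes "category C" and Z: "zero_object C Z" and \<psi>: "\<psi> \<in> Hom C W Z" "iso_arr C \<psi>"
  shows "zero_object C W"
proof -
  interpret category C by fact
  note [simp] = \<psi>[unfolded in_Hom]
  have W: "W \<in> Obj C" using Dom_Obj[of \<psi>] by simp
  have "\<exists>!f. f \<in> Hom C A W" if A: "A \<in> Obj C" for A
  proof -
    obtain f where f': "f \<in> Hom C A Z" and uniq: "\<And>g. g \<in> Hom C A Z \<Longrightarrow> g = f"
      using Z A unfolding zero_object_def by metis
    note f = f'[unfolded in_Hom]
    have "inv_arr C \<psi> \<cdot> f \<in> Hom C A W" using f by (simp add: in_Hom)
    moreover have "g = inv_arr C \<psi> \<cdot> f" if g: "g \<in> Hom C A W" for g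
    proof -
      have "\<psi> \<cdot> g = f" using g by (intro uniq) (simp add: in_Hom)
      then show ?thesis using inv_arr_cancel(1)[of \<psi> g] g by (simp add: in_Hom)
    qed
    ultimately show ?thesis by blast
  qed
  moreover have "\<exists>!f. f \<in> Hom C W A" if A: "A \<in> Obj C" for A
  proof -
    obtain f where f': "f \<in> Hom C Z A" and uniq: "\<And>g. g \<in> Hom C Z A \<Longrightarrow> g = f"
      using Z A unfolding zero_object_def by metis
    note f = f'[unfolded in_Hom]
    have "f \<cdot> \<psi> \<in> Hom C W A" using f by (simp add: in_Hom)
    moreover have "g = f \<cdot> \<psi>" if g: "g \<in> Hom C W A" for g
    proof -
      have "g \<cdot> inv_arr C \<psi> = f" using g by (intro uniq) (simp add: in_Hom)
      then show ?thesis using g by (auto simp: in_Hom)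
    qed
    ultimately show ?thesis by blast
  qed
  ultimately show ?thesis using W by (auto simp: zero_object_def)
qed

lemma bij_betw_ex1: "bij_betw t A B \<Longrightarrow> \<exists>!x. x \<in> B \<Longrightarrow> \<exists>!x. x \<in> A"
  unfolding bij_betw_def inj_on_def by blast

text \<open>Hom-sets to and from \<open>A\<close> are in bijection with those to and from
  \<open>fobj F A\<close>, so unique existence passes back to \<open>C\<close>.\<close>

lemma (in fully_faithful_ess_surj) zero_object_reflect:
  assumes "A \<in> Obj C" "zero_object D (fobj F A)"
  shows "zero_object C A"
  using assms bij_betw_ex1[OF farr_bij] by (simp add: zero_object_def)

text \<open>Additivity is assumed of the target because hom-groups are pulled back along
  \<open>farr F\<close>; additivity of the source is then a consequence.\<close>

locale equivalence_to_add = fully_faithful_ess_surj C D F + D: add_category D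
  for C :: "('o, 'm) category" and D :: "('p, 'k) category"
    and F :: "('o, 'm, 'p, 'k) cat_functor"
begin

text \<open>\<open>A\<close> and \<open>B\<close> are arguments because \<open>fobj F\<close> need
  not be injective: \<open>k\<close> alone does not determine the hom-set in which its preimage
  lies.\<close>

definition lift :: "'o \<Rightarrow> 'o \<Rightarrow> 'k \<Rightarrow> 'm" where
  "lift A B = inv_into (Hom C A B) (farr F)"

lemma lift_props [simp]:
  assumes "A \<in> Obj C" "B \<in> Obj C" "k \<in> Arr D" "Dom D k = fobj F A" "Cod D k = fobj F B"
  shows "lift A B k \<in> Arr C" "Dom C (lift A B k) = A" "Cod C (lift A B k) = B"
    "farr F (lift A B k) = k"
proof -
  have k: "k \<in> farr F ` Hom C A B"
    using farr_bij[of A B] assms by (simp add: bij_betw_def in_Hom)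
  show "lift A B k \<in> Arr C" "Dom C (lift A B k) = A" "Cod C (lift A B k) = B"
    "farr F (lift A B k) = k"
    using inv_into_into[OF k] f_inv_into_f[OF k] by (simp_all add: in_Hom lift_def)
qed

definition lift_group :: "'o \<Rightarrow> 'o \<Rightarrow> 'm monoid" where
  "lift_group A B = \<lparr>carrier = Hom C A B,
     mult = (\<lambda>f g. lift A B (add_arr D (farr F f) (farr F g))),
     one = lift A B (zero_arr D (fobj F A) (fobj F B))\<rparr>"

lemma lift_group_comm_group:
  assumes A: "A \<in> Obj C" and B: "B \<in> Obj C"
  shows "comm_group (lift_group A B)"
proof -
  note [simp] = A B
  show ?thesis
  \<comment> \<open>Each law is an equation between arrows of \<open>C\<close>. By faithfulness it
    suffices to compare the images in \<open>D\<close>, where \<open>lift\<close>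
    disappears.\<close>
  proof (rule comm_groupI, goal_cases)
    case (3 x y z)
    then show ?case
      by (intro farr_eqD) (simp_all add: lift_group_def in_Hom D.add_assoc)
  next
    case (4 x y)
    then show ?case
      by (intro farr_eqD) (simp_all add: lift_group_def in_Hom D.add_commute)
  next
    case (6 x)
    have "lift A B (neg_arr D (farr F x)) \<in> carrier (lift_group A B)"
      using 6 by (simp add: lift_group_def in_Hom)
    moreover have "lift A B (neg_arr D (farr F x)) \<otimes>\<^bsub>lift_group A B\<^esub> x = \<one>\<^bsub>lift_group A B\<^esub>"
      using 6 D.add_commute[of "farr F x" "neg_arr D (farr F x)"]
      by (intro farr_eqD) (simp_all add: lift_group_def in_Hom)
    ultimately show ?case by blast
  next
    case (5 x)
    then show ?case by (intro farr_eqD) (simp_all add: lift_group_def in_Hom)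
  qed (simp_all add: lift_group_def in_Hom)
qed

lemma lift_group_additive: "additive_structure C lift_group"
  unfolding additive_structure_def
proof (intro conjI ballI)
  have "(\<lambda>f. g \<cdot>\<^bsub>C\<^esub> f) \<in> hom (lift_group A B) (lift_group A E)"
    if "A \<in> Obj C" "B \<in> Obj C" "E \<in> Obj C" "g \<in> Hom C B E" for A B E g
    using that by (intro homI farr_eqD)
      (simp_all add: lift_group_def in_Hom farr_comp D.comp_add)
  moreover have "(\<lambda>g. g \<cdot>\<^bsub>C\<^esub> f) \<in> hom (lift_group B E) (lift_group A E)"
    if "A \<in> Obj C" "B \<in> Obj C" "E \<in> Obj C" "f \<in> Hom C A B" for A B E f
    using that by (intro homI farr_eqD)
      (simp_all add: lift_group_def in_Hom farr_comp D.add_comp)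
  moreover have "carrier (lift_group A B) = Hom C A B" for A B
    by (simp add: lift_group_def)
  ultimately show "ab_enrichment C lift_group"
    unfolding ab_enrichment_def using lift_group_comm_group by blast
next
  obtain Z where Z: "zero_object D Z"
    using D.hom_group_additive by (auto simp: additive_structure_def)
  then obtain W \<psi> where "W \<in> Obj C" "\<psi> \<in> Hom D (fobj F W) Z" "iso_arr D \<psi>"
    using ess_surj[of Z] by (auto simp: zero_object_def)
  then have "zero_object C W"
    using zero_object_reflect zero_object_iso[OF D.category_axioms Z] by blast
  then show "\<exists>Z. zero_object C Z" ..
next
  fix A B assume AB: "A \<in> Obj C" "B \<in> Obj C"
  obtain S where S: "is_biproduct D (hom_group D) (fobj F A) (fobj F B) S"
    using D.hom_group_additive AB unfolding additive_structure_def by (metis fobj_Obj)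
  obtain W \<psi> where W: "W \<in> Obj C" "\<psi> \<in> Hom D (fobj F W) (sumobj S)" "iso_arr D \<psi>"
    using ess_surj[of "sumobj S"] S by (auto simp: is_biproduct_def)
  note [simp] = AB W[unfolded in_Hom]
  \<comment> \<open>The biproduct \<open>S\<close> in \<open>D\<close> need not have its sum in the
    image of \<open>F\<close>. Conjugation by \<open>\<psi>\<close> moves it to
    \<open>fobj F W\<close>, after which all four structure arrows run between image objects and can
    be lifted.\<close>
  let ?T = "\<lparr>sumobj = W, inj1 = lift A W (inv_arr D \<psi> \<cdot>\<^bsub>D\<^esub> inj1 S),
    inj2 = lift B W (inv_arr D \<psi> \<cdot>\<^bsub>D\<^esub> inj2 S),
    proj1 = lift W A (proj1 S \<cdot>\<^bsub>D\<^esub> \<psi>), proj2 = lift W B (proj2 S \<cdot>\<^bsub>D\<^esub> \<psi>)\<rparr>"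
  have sum: "add_arr D (inj1 S \<cdot>\<^bsub>D\<^esub> proj1 S) (inj2 S \<cdot>\<^bsub>D\<^esub> proj2 S) = Ide D (sumobj S)"
    using S by (simp add: is_biproduct_def add_arr_def in_Hom)
  have S': "inj1 S \<in> Arr D" "Dom D (inj1 S) = fobj F A" "Cod D (inj1 S) = sumobj S"
    "inj2 S \<in> Arr D" "Dom D (inj2 S) = fobj F B" "Cod D (inj2 S) = sumobj S"
    "proj1 S \<in> Arr D" "Dom D (proj1 S) = sumobj S" "Cod D (proj1 S) = fobj F A"
    "proj2 S \<in> Arr D" "Dom D (proj2 S) = sumobj S" "Cod D (proj2 S) = fobj F B"
    "proj1 S \<cdot>\<^bsub>D\<^esub> inj1 S = Ide D (fobj F A)" "proj2 S \<cdot>\<^bsub>D\<^esub> inj2 S = Ide D (fobj F B)"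
    "proj1 S \<cdot>\<^bsub>D\<^esub> inj2 S = zero_arr D (fobj F B) (fobj F A)"
    "proj2 S \<cdot>\<^bsub>D\<^esub> inj1 S = zero_arr D (fobj F A) (fobj F B)"
    using S by (simp_all add: is_biproduct_def in_Hom zero_arr_def)
  have "add_arr D ((inv_arr D \<psi> \<cdot>\<^bsub>D\<^esub> inj1 S) \<cdot>\<^bsub>D\<^esub> (proj1 S \<cdot>\<^bsub>D\<^esub> \<psi>))
      ((inv_arr D \<psi> \<cdot>\<^bsub>D\<^esub> inj2 S) \<cdot>\<^bsub>D\<^esub> (proj2 S \<cdot>\<^bsub>D\<^esub> \<psi>)) =
    inv_arr D \<psi> \<cdot>\<^bsub>D\<^esub> (add_arr D (inj1 S \<cdot>\<^bsub>D\<^esub> proj1 S) (inj2 S \<cdot>\<^bsub>D\<^esub> proj2 S) \<cdot>\<^bsub>D\<^esub> \<psi>)"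
    using S' by (simp add: D.comp_add D.add_comp)
  also have "\<dots> = Ide D (fobj F W)" unfolding sum using S' by simp
  finally have sum': "add_arr D ((inv_arr D \<psi> \<cdot>\<^bsub>D\<^esub> inj1 S) \<cdot>\<^bsub>D\<^esub> (proj1 S \<cdot>\<^bsub>D\<^esub> \<psi>))
      ((inv_arr D \<psi> \<cdot>\<^bsub>D\<^esub> inj2 S) \<cdot>\<^bsub>D\<^esub> (proj2 S \<cdot>\<^bsub>D\<^esub> \<psi>)) = Ide D (fobj F W)" .
  have "inj1 ?T \<in> Hom C A W" "inj2 ?T \<in> Hom C B W" "proj1 ?T \<in> Hom C W A" "proj2 ?T \<in> Hom C W B"
    by (simp_all add: S' in_Hom)
  moreover have "proj1 ?T \<cdot>\<^bsub>C\<^esub> inj1 ?T = Ide C A" "proj2 ?T \<cdot>\<^bsub>C\<^esub> inj2 ?T = Ide C B"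
    "proj1 ?T \<cdot>\<^bsub>C\<^esub> inj2 ?T = \<one>\<^bsub>lift_group B A\<^esub>" "proj2 ?T \<cdot>\<^bsub>C\<^esub> inj1 ?T = \<one>\<^bsub>lift_group A B\<^esub>"
    by (intro farr_eqD; simp add: S' lift_group_def farr_comp)+
  moreover have "inj1 ?T \<cdot>\<^bsub>C\<^esub> proj1 ?T \<otimes>\<^bsub>lift_group W W\<^esub> inj2 ?T \<cdot>\<^bsub>C\<^esub> proj2 ?T = Ide C W"
    using sum' by (intro farr_eqD) (simp_all add: S' lift_group_def farr_comp del: D.comp_assoc)
  ultimately have "is_biproduct C lift_group A B ?T"
    using W(1) unfolding is_biproduct_def by (metis biprod_data.select_convs(1))
  then show "\<exists>S. is_biproduct C lift_group A B S" by blast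
qed

lemma additive_source: "add_category C"
  using lift_group_additive C.category_axioms
  by (auto simp: add_category_def add_category_axioms_def additive_category_def)

end

section \<open>Additivity of the functor\<close>

sublocale equivalence_to_add \<subseteq> C: add_category C
  by (rule additive_source)

context equivalence_to_add
begin

text \<open>\<open>hom_group C\<close> is an arbitrary choice of enrichment, whereas
  \<open>lift_group\<close> is compatible with \<open>F\<close> by construction; uniqueness
  transfers the compatibility.\<close>

lemma farr_zero [simp]:
  assumes "A \<in> Obj C" "B \<in> Obj C"
  shows "farr F (zero_arr C A B) = zero_arr D (fobj F A) (fobj F B)"
  using additive_structure_unit_unique[OF C.category_axioms C.hom_group_additive
      lift_group_additive assms] assms
  by (simp add: zero_arr_def[of C]) (simp add: lift_group_def)

lemma farr_add:
  assumes "f \<in> Arr C" "g \<in> Arr C" "Dom C g = Dom C f" "Cod C g = Cod C f"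
  shows "farr F (add_arr C f g) = add_arr D (farr F f) (farr F g)"
  using additive_structure_unique[OF C.category_axioms C.hom_group_additive
      lift_group_additive, of f "Dom C f" "Cod C f" g] assms
  by (simp add: add_arr_def[of C] in_Hom) (simp add: lift_group_def)

lemma farr_neg:
  assumes "f \<in> Arr C"
  shows "farr F (neg_arr C f) = neg_arr D (farr F f)"
  using assms by (intro D.neg_unique) (simp_all flip: farr_add)

lemma farr_additive: "additive_functor C D F"
  unfolding additive_functor_def
proof (intro conjI ballI is_functor)
  fix A B assume AB: "A \<in> Obj C" "B \<in> Obj C"
  show "farr F \<in> hom (hom_group C A B) (hom_group D (fobj F A) (fobj F B))"
  proof (rule homI)
    fix f g assume "f \<in> carrier (hom_group C A B)" "g \<in> carrier (hom_group C A B)"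
    then show "farr F (f \<otimes>\<^bsub>hom_group C A B\<^esub> g) =
        farr F f \<otimes>\<^bsub>hom_group D (fobj F A) (fobj F B)\<^esub> farr F g"
      using farr_add[of f g] AB by (simp add: C.carrier_hom_group in_Hom add_arr_def)
  qed (use AB in \<open>simp add: C.carrier_hom_group D.carrier_hom_group in_Hom\<close>)
qed

end

section \<open>Transport of complexes\<close>

text \<open>Only \<open>composable_seq\<close> is demanded of both sides, as in
  \<open>n_kernel\<close> and \<open>n_cokernel\<close>. A mapping cone can thus be compared without
  first showing that its consecutive differentials compose to zero.\<close>

definition seq_iso ::
  "('o, 'm) category \<Rightarrow> nat \<Rightarrow> ('o, 'm) sequence \<Rightarrow> ('o, 'm) sequence \<Rightarrow> (nat \<Rightarrow> 'm) \<Rightarrow> bool"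
  where
  "seq_iso C m X Y \<phi> \<longleftrightarrow> composable_seq C m X \<and> composable_seq C m Y \<and>
     (\<forall>i \<le> m + 1. \<phi> i \<in> Hom C (obj X i) (obj Y i) \<and> iso_arr C (\<phi> i)) \<and>
     (\<forall>i \<le> m. \<phi> (i + 1) \<cdot>\<^bsub>C\<^esub> diff X i = diff Y i \<cdot>\<^bsub>C\<^esub> \<phi> i)"

lemma composable_seqD:
  assumes "composable_seq C m X"
  shows "i \<le> m + 1 \<Longrightarrow> obj X i \<in> Obj C"
    and "i \<le> m \<Longrightarrow> diff X i \<in> Arr C" "i \<le> m \<Longrightarrow> Dom C (diff X i) = obj X i"
    and "i \<le> m \<Longrightarrow> Cod C (diff X i) = obj X (Suc i)"
  using assms by (simp_all add: composable_seq_def in_Hom)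

lemma seq_isoD:
  assumes "seq_iso C m X Y \<phi>"
  shows "composable_seq C m X" "composable_seq C m Y"
    and "i \<le> m + 1 \<Longrightarrow> \<phi> i \<in> Arr C" "i \<le> m + 1 \<Longrightarrow> Dom C (\<phi> i) = obj X i"
    and "i \<le> m + 1 \<Longrightarrow> Cod C (\<phi> i) = obj Y i" "i \<le> m + 1 \<Longrightarrow> iso_arr C (\<phi> i)"
    and "i \<le> m \<Longrightarrow> \<phi> (Suc i) \<cdot>\<^bsub>C\<^esub> diff X i = diff Y i \<cdot>\<^bsub>C\<^esub> \<phi> i"
  using assms by (simp_all add: seq_iso_def in_Hom)

lemma complex_morD:
  assumes "complex_mor C m X Y f"
  shows "cochain_complex C m X" "cochain_complex C m Y"
    and "composable_seq C m X" "composable_seq C m Y"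
    and "i \<le> m + 1 \<Longrightarrow> f i \<in> Arr C" "i \<le> m + 1 \<Longrightarrow> Dom C (f i) = obj X i"
    and "i \<le> m + 1 \<Longrightarrow> Cod C (f i) = obj Y i"
    and "i \<le> m \<Longrightarrow> f (Suc i) \<cdot>\<^bsub>C\<^esub> diff X i = diff Y i \<cdot>\<^bsub>C\<^esub> f i"
  using assms by (simp_all add: complex_mor_def cochain_complex_def in_Hom)

lemma map_seq_simps [simp]:
  "obj (map_seq F X) i = fobj F (obj X i)" "diff (map_seq F X) i = farr F (diff X i)"
  by (simp_all add: map_seq_def)

text \<open>Replaces the objects of \<open>X\<close> along isomorphisms \<open>\<beta>\<close>. With
  identities in most degrees it gives a sequence a prescribed object or differential in the
  remaining ones.\<close>

definition transport_seq ::
  "('o, 'm) category \<Rightarrow> ('o, 'm) sequence \<Rightarrow> (nat \<Rightarrow> 'm) \<Rightarrow> ('o, 'm) sequence" where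
  "transport_seq C X \<beta> = \<lparr>obj = (\<lambda>i. Cod C (\<beta> i)),
     diff = (\<lambda>i. \<beta> (i + 1) \<cdot>\<^bsub>C\<^esub> (diff X i \<cdot>\<^bsub>C\<^esub> inv_arr C (\<beta> i)))\<rparr>"

lemma (in category) seq_iso_transport:
  assumes X: "composable_seq C m X"
    and \<beta>: "\<And>i. i \<le> m + 1 \<Longrightarrow> iso_arr C (\<beta> i)" "\<And>i. i \<le> m + 1 \<Longrightarrow> Dom C (\<beta> i) = obj X i"
  shows "seq_iso C m X (transport_seq C X \<beta>) \<beta>"
  using X iso_arr_Arr[OF \<beta>(1)] \<beta>
  by (simp add: seq_iso_def in_Hom transport_seq_def composable_seq_def)

section \<open>Exactness along bijections of hom-sets\<close>

lemma (in category) bij_betw_conj: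
  assumes "iso_arr C a" "iso_arr C b"
  shows "bij_betw (\<lambda>k. b \<cdot> (k \<cdot> inv_arr C a)) (Hom C (Dom C a) (Dom C b)) (Hom C (Cod C a) (Cod C b))"
  using assms iso_arr_Arr[OF assms(1)] iso_arr_Arr[OF assms(2)]
  by (intro bij_betwI[where g = "\<lambda>k. inv_arr C b \<cdot> (k \<cdot> a)"]) (auto simp: in_Hom)

text \<open>Used with \<open>e\<close> and \<open>e'\<close> as composition with a differential and
  \<open>z\<close>, \<open>z'\<close> as zero morphisms, so that kernels correspond;
  \<open>bij_betw_image_comm\<close> does the same for images. Injectivity of \<open>t2\<close>
  brings the equation back.\<close>

lemma bij_betw_fibre:
  assumes "bij_betw t1 A1 B1" "bij_betw t2 A2 B2"
    and "\<And>g. g \<in> A1 \<Longrightarrow> e g \<in> A2" "\<And>g. g \<in> A1 \<Longrightarrow> e' (t1 g) = t2 (e g)"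
    and "z \<in> A2" "t2 z = z'"
  shows "{g \<in> B1. e' g = z'} = t1 ` {g \<in> A1. e g = z}"
  using assms by (auto simp: bij_betw_def inj_on_def image_iff)

lemma bij_betw_image_comm:
  assumes "bij_betw t0 A0 B0" and "\<And>g. g \<in> A0 \<Longrightarrow> t1 (d g) = d' (t0 g)"
  shows "d' ` B0 = t1 ` d ` A0"
  using assms by (force simp: bij_betw_def image_iff)

context equivalence_to_add
begin

lemma map_composable:
  "composable_seq C m X \<Longrightarrow> composable_seq D m (map_seq F X)"
  by (simp add: composable_seq_def in_Hom)

text \<open>Precomposed with \<open>\<phi> i\<close>, the composite of two differentials of
  \<open>Y\<close> becomes, by the two squares, \<open>\<phi> (i + 2)\<close> after the image of a
  zero composite.\<close>

lemma cochain_transport: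
  assumes \<phi>: "seq_iso D m (map_seq F X) Y \<phi>" and X: "cochain_complex C m X"
  shows "cochain_complex D m Y"
  unfolding cochain_complex_def
proof (intro conjI allI impI)
  note [simp] = seq_isoD(3-6)[OF \<phi>] composable_seqD[OF seq_isoD(2)[OF \<phi>]]
  have Xc: "composable_seq C m X" using X by (simp add: cochain_complex_def)
  note [simp] = composable_seqD[OF Xc]
  show "composable_seq D m Y" by (rule seq_isoD[OF \<phi>])
  fix i assume i: "i < m"
  have "(diff Y (i + 1) \<cdot>\<^bsub>D\<^esub> diff Y i) \<cdot>\<^bsub>D\<^esub> \<phi> i = diff Y (i + 1) \<cdot>\<^bsub>D\<^esub> (\<phi> (i + 1) \<cdot>\<^bsub>D\<^esub> farr F (diff X i))"
    using i seq_isoD(7)[OF \<phi>, of i] by simp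
  also have "\<dots> = (diff Y (i + 1) \<cdot>\<^bsub>D\<^esub> \<phi> (i + 1)) \<cdot>\<^bsub>D\<^esub> farr F (diff X i)"
    using i by simp
  also have "\<dots> = \<phi> (i + 2) \<cdot>\<^bsub>D\<^esub> farr F (diff X (i + 1) \<cdot>\<^bsub>C\<^esub> diff X i)"
    using i by (simp add: farr_comp flip: seq_isoD(7)[OF \<phi>, of "Suc i", simplified])
  also have "\<dots> = zero_arr D (obj Y i) (obj Y (i + 2)) \<cdot>\<^bsub>D\<^esub> \<phi> i"
    using i X by (simp add: cochain_complex_def)
  finally have "(diff Y (i + 1) \<cdot>\<^bsub>D\<^esub> diff Y i) \<cdot>\<^bsub>D\<^esub> \<phi> i =
    zero_arr D (obj Y i) (obj Y (i + 2)) \<cdot>\<^bsub>D\<^esub> \<phi> i" .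
  then show "diff Y (i + 1) \<cdot>\<^bsub>D\<^esub> diff Y i = zero_arr D (obj Y i) (obj Y (i + 2))"
    by (rule D.iso_arr_epi[rotated 5]) (use i in simp_all)
qed

lemma n_kernel_transport:
  assumes \<phi>: "seq_iso D n (map_seq F X) Y \<phi>" and X: "n_kernel n C X"
  shows "n_kernel n D Y"
  unfolding n_kernel_def
proof (intro conjI ballI)
  note [simp] = seq_isoD(3-6)[OF \<phi>] composable_seqD[OF seq_isoD(2)[OF \<phi>]]
  have Xc: "composable_seq C n X" using X by (simp add: n_kernel_def)
  note [simp] = composable_seqD[OF Xc]
  show "composable_seq D n Y" by (rule seq_isoD[OF \<phi>])
  fix Z assume Z [simp]: "Z \<in> Obj D"
  then obtain W \<psi> where W: "W \<in> Obj C" "\<psi> \<in> Hom D (fobj F W) Z" "iso_arr D \<psi>"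
    using ess_surj by blast
  note [simp] = W[unfolded in_Hom]
  \<comment> \<open>The bijection given by \<open>F\<close> followed by conjugation with
    \<open>\<psi>\<close> and \<open>\<phi> i\<close>. It identifies the hom-sequence of
    \<open>X\<close> at \<open>W\<close> with that of \<open>Y\<close> at \<open>Z\<close>, since
    \<open>t_diff\<close> makes it commute with the differentials.\<close>
  define t where "t i g = \<phi> i \<cdot>\<^bsub>D\<^esub> (farr F g \<cdot>\<^bsub>D\<^esub> inv_arr D \<psi>)" for i g
  have t: "bij_betw (t i) (Hom C W (obj X i)) (Hom D Z (obj Y i))" if i: "i \<le> n + 1" for i
    using bij_betw_trans[OF farr_bij[of W "obj X i"]] D.bij_betw_conj[of \<psi> "\<phi> i"] i
    by (simp add: t_def[abs_def] comp_def)
  have t_diff: "diff Y i \<cdot>\<^bsub>D\<^esub> t i g = t (i + 1) (diff X i \<cdot>\<^bsub>C\<^esub> g)"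
    if i: "i \<le> n" and g: "g \<in> Hom C W (obj X i)" for i g
  proof -
    note [simp] = g[unfolded in_Hom]
    have "diff Y i \<cdot>\<^bsub>D\<^esub> t i g = (diff Y i \<cdot>\<^bsub>D\<^esub> \<phi> i) \<cdot>\<^bsub>D\<^esub> (farr F g \<cdot>\<^bsub>D\<^esub> inv_arr D \<psi>)"
      using i by (simp add: t_def)
    also have "\<dots> = t (i + 1) (diff X i \<cdot>\<^bsub>C\<^esub> g)"
      using i by (simp add: t_def farr_comp flip: seq_isoD(7)[OF \<phi>, of i, simplified])
    finally show ?thesis .
  qed
  have t_zero: "t i (zero_arr C W (obj X i)) = zero_arr D Z (obj Y i)" if "i \<le> n + 1" for i
    using that by (simp add: t_def)
  have zero_Hom: "zero_arr C W (obj X i) \<in> Hom C W (obj X i)" if "i \<le> n + 1" for i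
    using that by (simp add: in_Hom)
  have fibre: "{g \<in> Hom D Z (obj Y i). diff Y i \<cdot>\<^bsub>D\<^esub> g = zero_arr D Z (obj Y (i + 1))} =
    t i ` {g \<in> Hom C W (obj X i). diff X i \<cdot>\<^bsub>C\<^esub> g = zero_arr C W (obj X (i + 1))}"
    if i: "i \<le> n" for i
  proof (rule bij_betw_fibre[OF t t])
    show "diff X i \<cdot>\<^bsub>C\<^esub> g \<in> Hom C W (obj X (i + 1))" if "g \<in> Hom C W (obj X i)" for g
      using i that by (simp add: in_Hom)
    show "t (i + 1) (zero_arr C W (obj X (i + 1))) = zero_arr D Z (obj Y (i + 1))"
      using i by (intro t_zero) simp
    show "zero_arr C W (obj X (i + 1)) \<in> Hom C W (obj X (i + 1))"
      using i by (intro zero_Hom) simp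
  qed (use i t_diff in simp_all)
  show "{g \<in> Hom D Z (obj Y 0). diff Y 0 \<cdot>\<^bsub>D\<^esub> g = zero_arr D Z (obj Y 1)}
      = {zero_arr D Z (obj Y 0)}"
    using fibre[of 0] X W(1) t_zero[of 0] by (simp add: n_kernel_def)
  show "\<forall>i < n.
      {g \<in> Hom D Z (obj Y (i + 1)). diff Y (i + 1) \<cdot>\<^bsub>D\<^esub> g = zero_arr D Z (obj Y (i + 2))}
        = (\<lambda>h. diff Y i \<cdot>\<^bsub>D\<^esub> h) ` Hom D Z (obj Y i)"
  proof (intro allI impI)
    fix i assume i: "i < n"
    have "(\<lambda>h. diff Y i \<cdot>\<^bsub>D\<^esub> h) ` Hom D Z (obj Y i) =
        t (i + 1) ` (\<lambda>h. diff X i \<cdot>\<^bsub>C\<^esub> h) ` Hom C W (obj X i)"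
      using i t_diff by (intro bij_betw_image_comm[OF t]) simp_all
    then show "{g \<in> Hom D Z (obj Y (i + 1)). diff Y (i + 1) \<cdot>\<^bsub>D\<^esub> g = zero_arr D Z (obj Y (i + 2))}
        = (\<lambda>h. diff Y i \<cdot>\<^bsub>D\<^esub> h) ` Hom D Z (obj Y i)"
      using fibre[of "i + 1"] X W(1) i by (simp add: n_kernel_def)
  qed
qed

lemma n_cokernel_transport:
  assumes \<phi>: "seq_iso D n (map_seq F X) Y \<phi>" and X: "n_cokernel n C X"
  shows "n_cokernel n D Y"
  unfolding n_cokernel_def
proof (intro conjI ballI)
  note [simp] = seq_isoD(3-6)[OF \<phi>] composable_seqD[OF seq_isoD(2)[OF \<phi>]]
  have Xc: "composable_seq C n X" using X by (simp add: n_cokernel_def)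
  note [simp] = composable_seqD[OF Xc]
  show "composable_seq D n Y" by (rule seq_isoD[OF \<phi>])
  fix Z assume Z [simp]: "Z \<in> Obj D"
  then obtain W \<psi> where W: "W \<in> Obj C" "\<psi> \<in> Hom D (fobj F W) Z" "iso_arr D \<psi>"
    using ess_surj by blast
  note [simp] = W[unfolded in_Hom]
  define t where "t i g = \<psi> \<cdot>\<^bsub>D\<^esub> (farr F g \<cdot>\<^bsub>D\<^esub> inv_arr D (\<phi> i))" for i g
  have t: "bij_betw (t i) (Hom C (obj X i) W) (Hom D (obj Y i) Z)" if i: "i \<le> n + 1" for i
    using bij_betw_trans[OF farr_bij[of "obj X i" W]] D.bij_betw_conj[of "\<phi> i" \<psi>] i
    by (simp add: t_def[abs_def] comp_def)
  \<comment> \<open>Here the inverse of \<open>\<phi> (i + 1)\<close> stands directly before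
    \<open>diff Y i\<close>, where no square applies; precomposition with \<open>\<phi> i\<close>
    creates the square and cancels the inverse.\<close>
  have t_diff: "t (i + 1) g \<cdot>\<^bsub>D\<^esub> diff Y i = t i (g \<cdot>\<^bsub>C\<^esub> diff X i)"
    if i: "i \<le> n" and g: "g \<in> Hom C (obj X (i + 1)) W" for i g
  proof (rule D.iso_arr_epi[of "\<phi> i"])
    note [simp] = g[unfolded in_Hom]
    show "(t (i + 1) g \<cdot>\<^bsub>D\<^esub> diff Y i) \<cdot>\<^bsub>D\<^esub> \<phi> i = t i (g \<cdot>\<^bsub>C\<^esub> diff X i) \<cdot>\<^bsub>D\<^esub> \<phi> i"
      using i by (simp add: t_def farr_comp flip: seq_isoD(7)[OF \<phi>, of i, simplified])
  qed (use i g in \<open>simp_all add: t_def in_Hom\<close>)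
  have t_zero: "t i (zero_arr C (obj X i) W) = zero_arr D (obj Y i) Z" if "i \<le> n + 1" for i
    using that by (simp add: t_def)
  have zero_Hom: "zero_arr C (obj X i) W \<in> Hom C (obj X i) W" if "i \<le> n + 1" for i
    using that by (simp add: in_Hom)
  have fibre: "{g \<in> Hom D (obj Y (i + 1)) Z. g \<cdot>\<^bsub>D\<^esub> diff Y i = zero_arr D (obj Y i) Z} =
    t (i + 1) ` {g \<in> Hom C (obj X (i + 1)) W. g \<cdot>\<^bsub>C\<^esub> diff X i = zero_arr C (obj X i) W}"
    if i: "i \<le> n" for i
  proof (rule bij_betw_fibre[OF t t])
    show "g \<cdot>\<^bsub>C\<^esub> diff X i \<in> Hom C (obj X i) W" if "g \<in> Hom C (obj X (i + 1)) W" for g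
      using i that by (simp add: in_Hom)
    show "t i (zero_arr C (obj X i) W) = zero_arr D (obj Y i) Z"
      using i by (intro t_zero) simp
    show "zero_arr C (obj X i) W \<in> Hom C (obj X i) W"
      using i by (intro zero_Hom) simp
  qed (use i t_diff in simp_all)
  show "{g \<in> Hom D (obj Y (n + 1)) Z. g \<cdot>\<^bsub>D\<^esub> diff Y n = zero_arr D (obj Y n) Z}
      = {zero_arr D (obj Y (n + 1)) Z}"
    using fibre[of n] X W(1) t_zero[of "n + 1"] by (simp add: n_cokernel_def)
  show "\<forall>i < n.
      {g \<in> Hom D (obj Y (i + 1)) Z. g \<cdot>\<^bsub>D\<^esub> diff Y i = zero_arr D (obj Y i) Z}
        = (\<lambda>h. h \<cdot>\<^bsub>D\<^esub> diff Y (i + 1)) ` Hom D (obj Y (i + 2)) Z"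
  proof (intro allI impI)
    fix i assume i: "i < n"
    have "(\<lambda>h. h \<cdot>\<^bsub>D\<^esub> diff Y (i + 1)) ` Hom D (obj Y (i + 2)) Z =
        t (i + 1) ` (\<lambda>h. h \<cdot>\<^bsub>C\<^esub> diff X (i + 1)) ` Hom C (obj X (i + 2)) W"
      using i t_diff[of "Suc i"] by (intro bij_betw_image_comm[OF t]) simp_all
    then show "{g \<in> Hom D (obj Y (i + 1)) Z. g \<cdot>\<^bsub>D\<^esub> diff Y i = zero_arr D (obj Y i) Z}
        = (\<lambda>h. h \<cdot>\<^bsub>D\<^esub> diff Y (i + 1)) ` Hom D (obj Y (i + 2)) Z"
      using fibre[of i] X W(1) i by (simp add: n_cokernel_def)
  qed
qed

lemma n_exact_transport:
  assumes "seq_iso D n (map_seq F X) Y \<phi>" "n_exact_seq n C X"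
  shows "n_exact_seq n D Y"
  using assms cochain_transport n_kernel_transport n_cokernel_transport
  by (auto simp: n_exact_seq_def)

lemma complex_mor_transport:
  assumes f: "complex_mor C m X Y f"
    and \<alpha>: "seq_iso D m (map_seq F X) X' \<alpha>" and \<beta>: "seq_iso D m (map_seq F Y) Y' \<beta>"
  shows "complex_mor D m X' Y' (\<lambda>i. \<beta> i \<cdot>\<^bsub>D\<^esub> (farr F (f i) \<cdot>\<^bsub>D\<^esub> inv_arr D (\<alpha> i)))"
proof -
  note [simp] = seq_isoD(3-6)[OF \<alpha>] composable_seqD[OF seq_isoD(2)[OF \<alpha>]]
  note [simp] = seq_isoD(3-6)[OF \<beta>] composable_seqD[OF seq_isoD(2)[OF \<beta>]]
  note [simp] = complex_morD(5-7)[OF f]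
    composable_seqD[OF complex_morD(3)[OF f]] composable_seqD[OF complex_morD(4)[OF f]]
  let ?f = "\<lambda>i. \<beta> i \<cdot>\<^bsub>D\<^esub> (farr F (f i) \<cdot>\<^bsub>D\<^esub> inv_arr D (\<alpha> i))"
  have "?f (i + 1) \<cdot>\<^bsub>D\<^esub> diff X' i = diff Y' i \<cdot>\<^bsub>D\<^esub> ?f i" if i: "i \<le> m" for i
  proof (rule D.iso_arr_epi[of "\<alpha> i"])
    have "(?f (i + 1) \<cdot>\<^bsub>D\<^esub> diff X' i) \<cdot>\<^bsub>D\<^esub> \<alpha> i = \<beta> (Suc i) \<cdot>\<^bsub>D\<^esub> farr F (f (Suc i) \<cdot>\<^bsub>C\<^esub> diff X i)"
      using i by (simp add: farr_comp flip: seq_isoD(7)[OF \<alpha>, of i, simplified])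
    also have "\<dots> = (\<beta> (Suc i) \<cdot>\<^bsub>D\<^esub> farr F (diff Y i)) \<cdot>\<^bsub>D\<^esub> farr F (f i)"
      using i by (simp add: farr_comp complex_morD(8)[OF f])
    also have "\<dots> = (diff Y' i \<cdot>\<^bsub>D\<^esub> \<beta> i) \<cdot>\<^bsub>D\<^esub> farr F (f i)"
      using i seq_isoD(7)[OF \<beta>, of i] by simp
    also have "\<dots> = (diff Y' i \<cdot>\<^bsub>D\<^esub> ?f i) \<cdot>\<^bsub>D\<^esub> \<alpha> i"
      using i by simp
    finally show "(?f (i + 1) \<cdot>\<^bsub>D\<^esub> diff X' i) \<cdot>\<^bsub>D\<^esub> \<alpha> i = (diff Y' i \<cdot>\<^bsub>D\<^esub> ?f i) \<cdot>\<^bsub>D\<^esub> \<alpha> i" .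
  qed (use i in simp_all)
  moreover have "?f i \<in> Hom D (obj X' i) (obj Y' i)" if "i \<le> m + 1" for i
    using that by (simp add: in_Hom)
  ultimately show ?thesis
    using cochain_transport[OF \<alpha> complex_morD(1)[OF f]] cochain_transport[OF \<beta> complex_morD(2)[OF f]]
    by (simp add: complex_mor_def)
qed

lemma seq_iso_map:
  assumes "composable_seq C m X"
  shows "seq_iso D m (map_seq F X) (map_seq F X) (\<lambda>i. Ide D (fobj F (obj X i)))"
  using assms by (simp add: seq_iso_def composable_seq_def in_Hom)

lemma n_exact_map:
  assumes "n_exact_seq n C X"
  shows "n_exact_seq n D (map_seq F X)"
  using n_exact_transport[OF seq_iso_map assms] assms
  by (simp add: n_exact_seq_def cochain_complex_def)

lemma weakly_isomorphic_map:
  assumes "weakly_isomorphic n C X Y"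
  shows "weakly_isomorphic n D (map_seq F X) (map_seq F Y)"
proof -
  \<comment> \<open>\<open>X\<close> and \<open>Y\<close> are generalised because the weak
    isomorphism may run in either direction.\<close>
  have "weak_iso n D (map_seq F X) (map_seq F Y) (\<lambda>i. farr F (f i))"
    if f: "weak_iso n C X Y f" for X Y f
  proof -
    have m: "complex_mor C n X Y f" using f by (simp add: weak_iso_def)
    note [simp] = complex_morD(5-7)[OF m]
      composable_seqD[OF complex_morD(3)[OF m]] composable_seqD[OF complex_morD(4)[OF m]]
    have "complex_mor D n (map_seq F X) (map_seq F Y) (\<lambda>i. farr F (f i))"
      using complex_mor_transport[OF m seq_iso_map[OF complex_morD(3)[OF m]]
          seq_iso_map[OF complex_morD(4)[OF m]]]
      by (simp add: complex_mor_def in_Hom complex_morD(8)[OF m] flip: farr_comp)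
    then show ?thesis
      using f n_exact_map by (auto simp: weak_iso_def)
  qed
  then show ?thesis using assms unfolding weakly_isomorphic_def by blast
qed

end

text \<open>All components being invertible, those in degrees 0 and 1 serve as the required adjacent
  pair.\<close>

lemma seq_iso_weakly_isomorphic:
  assumes "seq_iso C n X Y \<phi>" "n_exact_seq n C X" "n_exact_seq n C Y"
  shows "weakly_isomorphic n C X Y"
proof -
  have "complex_mor C n X Y \<phi>"
    using assms by (simp add: seq_iso_def complex_mor_def n_exact_seq_def)
  moreover have "iso_arr C (\<phi> 0)" "iso_arr C (\<phi> 1)"
    using assms(1) by (simp_all add: seq_iso_def)
  ultimately have "weak_iso n C X Y \<phi>"
    using assms(2,3) unfolding weak_iso_def by (auto intro!: exI[of _ 0])
  then show ?thesis by (auto simp: weakly_isomorphic_def)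
qed

lemma weakly_isomorphic_sym: "weakly_isomorphic n C X Y \<Longrightarrow> weakly_isomorphic n C Y X"
  by (auto simp: weakly_isomorphic_def)

lemma weakly_isomorphic_n_exact:
  "weakly_isomorphic n C X Y \<Longrightarrow> n_exact_seq n C X \<and> n_exact_seq n C Y"
  by (auto simp: weakly_isomorphic_def weak_iso_def)

lemma (in add_category) equivalence_to_add_id: "equivalence_to_add C C id_functor"
  by (simp add: equivalence_to_add_def fully_faithful_ess_surj_id category_axioms add_category_axioms)

lemma (in add_category) n_exact_seq_iso:
  assumes "seq_iso C n X Y \<phi>" "n_exact_seq n C X"
  shows "n_exact_seq n C Y"
proof -
  have "map_seq id_functor X = X" by (simp add: map_seq_def id_functor_def)
  then show ?thesis
    using equivalence_to_add.n_exact_transport[OF equivalence_to_add_id] assms by metis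
qed

section \<open>Transport of mapping cones\<close>

text \<open>The diagonal morphism \<open>a \<oplus> b\<close>. Source and target biproducts are
  independent, so it also compares two different biproducts of isomorphic pairs.\<close>

definition sum_arr ::
  "('o, 'm) category \<Rightarrow> ('o, 'm) biprod_data \<Rightarrow> ('o, 'm) biprod_data \<Rightarrow> 'm \<Rightarrow> 'm \<Rightarrow> 'm" where
  "sum_arr C S T a b = col_arr C T (a \<cdot>\<^bsub>C\<^esub> proj1 S) (b \<cdot>\<^bsub>C\<^esub> proj2 S)"

definition map_biprod ::
  "('o, 'm, 'p, 'k) cat_functor \<Rightarrow> ('o, 'm) biprod_data \<Rightarrow> ('p, 'k) biprod_data" where
  "map_biprod F S = \<lparr>sumobj = fobj F (sumobj S), inj1 = farr F (inj1 S), inj2 = farr F (inj2 S),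
     proj1 = farr F (proj1 S), proj2 = farr F (proj2 S)\<rparr>"

section \<open>Matrix calculus for biproducts\<close>

context add_category
begin

abbreviation biproduct :: "'a \<Rightarrow> 'a \<Rightarrow> ('a, 'b) biprod_data \<Rightarrow> bool" where
  "biproduct A B S \<equiv> A \<in> Obj C \<and> B \<in> Obj C \<and> is_biproduct C (hom_group C) A B S"

lemma biproduct_biprod: "\<lbrakk>A \<in> Obj C; B \<in> Obj C\<rbrakk> \<Longrightarrow> biproduct A B (biprod C A B)"
  using hom_group_additive unfolding additive_structure_def biprod_def by (meson someI_ex)

lemma biproductD:
  assumes "biproduct A B S"
  shows "A \<in> Obj C" "B \<in> Obj C" "sumobj S \<in> Obj C"
    and "inj1 S \<in> Arr C" "Dom C (inj1 S) = A" "Cod C (inj1 S) = sumobj S"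
    and "inj2 S \<in> Arr C" "Dom C (inj2 S) = B" "Cod C (inj2 S) = sumobj S"
    and "proj1 S \<in> Arr C" "Dom C (proj1 S) = sumobj S" "Cod C (proj1 S) = A"
    and "proj2 S \<in> Arr C" "Dom C (proj2 S) = sumobj S" "Cod C (proj2 S) = B"
    and "proj1 S \<cdot> inj1 S = Ide C A" "proj2 S \<cdot> inj2 S = Ide C B"
    and "proj1 S \<cdot> inj2 S = zero_arr C B A" "proj2 S \<cdot> inj1 S = zero_arr C A B"
    and "add_arr C (inj1 S \<cdot> proj1 S) (inj2 S \<cdot> proj2 S) = Ide C (sumobj S)"
  using assms by (simp_all add: is_biproduct_def in_Hom zero_arr_def add_arr_def)

lemma col_arr_props:
  assumes "biproduct A B T" "a \<in> Arr C" "b \<in> Arr C" "Dom C b = Dom C a" "Cod C a = A" "Cod C b = B"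
  shows "col_arr C T a b \<in> Arr C" "Dom C (col_arr C T a b) = Dom C a"
    and "Cod C (col_arr C T a b) = sumobj T"
    and "proj1 T \<cdot> col_arr C T a b = a" "proj2 T \<cdot> col_arr C T a b = b"
proof -
  note [simp] = biproductD[OF assms(1)] assms(2-6)
  show "col_arr C T a b \<in> Arr C" "Dom C (col_arr C T a b) = Dom C a"
    "Cod C (col_arr C T a b) = sumobj T"
    by (simp_all add: col_arr_def)
  show "proj1 T \<cdot> col_arr C T a b = a" "proj2 T \<cdot> col_arr C T a b = b"
    by (simp_all add: col_arr_def comp_add flip: comp_assoc)
qed

lemma col_arr_comp:
  assumes "biproduct A B T" "a \<in> Arr C" "b \<in> Arr C" "Dom C b = Dom C a" "Cod C a = A" "Cod C b = B"
    and "h \<in> Arr C" "Cod C h = Dom C a"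
  shows "col_arr C T a b \<cdot> h = col_arr C T (a \<cdot> h) (b \<cdot> h)"
  using biproductD[OF assms(1)] assms(2-) by (simp add: col_arr_def add_comp)

lemma row_arr_props:
  assumes "biproduct A B S" "a \<in> Arr C" "b \<in> Arr C" "Cod C b = Cod C a" "Dom C a = A" "Dom C b = B"
  shows "row_arr C S a b \<in> Arr C" "Dom C (row_arr C S a b) = sumobj S"
    and "Cod C (row_arr C S a b) = Cod C a"
  using biproductD[OF assms(1)] assms(2-) by (simp_all add: row_arr_def)

lemma comp_row_arr:
  assumes "biproduct A B S" "a \<in> Arr C" "b \<in> Arr C" "Cod C b = Cod C a" "Dom C a = A" "Dom C b = B"
    and "h \<in> Arr C" "Dom C h = Cod C a"
  shows "h \<cdot> row_arr C S a b = row_arr C S (h \<cdot> a) (h \<cdot> b)"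
  using biproductD[OF assms(1)] assms(2-) by (simp add: row_arr_def comp_add)

lemma mat_arr_props:
  assumes "biproduct A B S" "biproduct A' B' T"
    and "a \<in> Hom C A A'" "b \<in> Hom C B A'" "c \<in> Hom C A B'" "e \<in> Hom C B B'"
  shows "mat_arr C S T a b c e \<in> Hom C (sumobj S) (sumobj T)"
  using row_arr_props[OF assms(1)] col_arr_props(1-3)[OF assms(2)] assms(3-)
  by (simp add: mat_arr_def in_Hom)

lemma sum_arr_props:
  assumes "biproduct A B S" "biproduct A' B' T" "a \<in> Hom C A A'" "b \<in> Hom C B B'"
  shows "sum_arr C S T a b \<in> Arr C" "Dom C (sum_arr C S T a b) = sumobj S"
    and "Cod C (sum_arr C S T a b) = sumobj T"
    and "proj1 T \<cdot> sum_arr C S T a b = a \<cdot> proj1 S" "proj2 T \<cdot> sum_arr C S T a b = b \<cdot> proj2 S"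
  using biproductD[OF assms(1)] col_arr_props[OF assms(2)] assms(3-)
  by (simp_all add: sum_arr_def in_Hom)

lemma sum_arr_col:
  assumes S: "biproduct A B S" and T: "biproduct A' B' T"
    and "a \<in> Hom C A A'" "b \<in> Hom C B B'"
    and x: "x \<in> Arr C" "y \<in> Arr C" "Dom C y = Dom C x" "Cod C x = A" "Cod C y = B"
  shows "sum_arr C S T a b \<cdot> col_arr C S x y = col_arr C T (a \<cdot> x) (b \<cdot> y)"
proof -
  note [simp] = biproductD[OF S] x assms(3,4)[unfolded in_Hom] col_arr_props[OF S x]
  show ?thesis unfolding sum_arr_def by (subst col_arr_comp[OF T]) simp_all
qed

lemma row_arr_sum:
  assumes S: "biproduct A B S" and T: "biproduct A' B' T"
    and ab: "a \<in> Hom C A A'" "b \<in> Hom C B B'"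
    and x: "x \<in> Arr C" "y \<in> Arr C" "Cod C y = Cod C x" "Dom C x = A'" "Dom C y = B'"
  shows "row_arr C T x y \<cdot> sum_arr C S T a b = row_arr C S (x \<cdot> a) (y \<cdot> b)"
  using biproductD[OF S] biproductD[OF T] x ab[unfolded in_Hom] sum_arr_props[OF S T ab]
  by (simp add: row_arr_def add_comp)

text \<open>The inverse is the diagonal of the inverses: either composite is the column of the two
  projections, which is the identity by the last biproduct equation.\<close>

lemma sum_arr_iso:
  assumes S: "biproduct A B S" and T: "biproduct A' B' T"
    and a: "a \<in> Hom C A A'" "iso_arr C a" and b: "b \<in> Hom C B B'" "iso_arr C b"
  shows "iso_arr C (sum_arr C S T a b)"
proof (rule iso_arrI)
  note [simp] = a[unfolded in_Hom] b[unfolded in_Hom]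
  have inv: "inv_arr C a \<in> Hom C A' A" "inv_arr C b \<in> Hom C B' B" by (simp_all add: in_Hom)
  note [simp] = biproductD[OF S] biproductD[OF T] sum_arr_props[OF S T a(1) b(1)]
    sum_arr_props[OF T S inv]
  have proj: "col_arr C U (proj1 U) (proj2 U) = Ide C (sumobj U)" if "biproduct P Q U" for P Q U
    using biproductD[OF that] by (simp add: col_arr_def)
  show "sum_arr C T S (inv_arr C a) (inv_arr C b) \<cdot> sum_arr C S T a b =
    Ide C (Dom C (sum_arr C S T a b))"
    using sum_arr_col[OF T S inv, of "a \<cdot> proj1 S" "b \<cdot> proj2 S"] proj[OF S]
    by (simp flip: sum_arr_def)
  show "sum_arr C S T a b \<cdot> sum_arr C T S (inv_arr C a) (inv_arr C b) =
    Ide C (Cod C (sum_arr C S T a b))"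
    using sum_arr_col[OF S T a(1) b(1), of "inv_arr C a \<cdot> proj1 T" "inv_arr C b \<cdot> proj2 T"] proj[OF T]
    by (simp flip: sum_arr_def)
qed (use sum_arr_props[OF S T a(1) b(1)] sum_arr_props[OF T S, of "inv_arr C a" "inv_arr C b"]
      a b in \<open>simp_all add: in_Hom\<close>)

text \<open>Since the comparison arrows are diagonal, commutation with the matrices splits into four
  entrywise equations in which no sums occur.\<close>

lemma sum_arr_mat:
  assumes S: "biproduct A B S" and T: "biproduct A' B' T"
    and S': "biproduct E G S'" and T': "biproduct E' G' T'"
    and m: "a \<in> Hom C A A'" "b \<in> Hom C B A'" "c \<in> Hom C A B'" "e \<in> Hom C B B'"
    and m': "a' \<in> Hom C E E'" "b' \<in> Hom C G E'" "c' \<in> Hom C E G'" "e' \<in> Hom C G G'"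
    and u: "u \<in> Hom C A E" "v \<in> Hom C B G" and w: "w \<in> Hom C A' E'" "z \<in> Hom C B' G'"
    and eq: "w \<cdot> a = a' \<cdot> u" "w \<cdot> b = b' \<cdot> v" "z \<cdot> c = c' \<cdot> u" "z \<cdot> e = e' \<cdot> v"
  shows "sum_arr C T T' w z \<cdot> mat_arr C S T a b c e = mat_arr C S' T' a' b' c' e' \<cdot> sum_arr C S S' u v"
proof -
  note [simp] = u[unfolded in_Hom] w[unfolded in_Hom] m[unfolded in_Hom] m'[unfolded in_Hom]
  note [simp] = row_arr_props[OF S] row_arr_props[OF S'] sum_arr_props[OF S S' u]
  have "sum_arr C T T' w z \<cdot> mat_arr C S T a b c e =
      col_arr C T' (w \<cdot> row_arr C S a b) (z \<cdot> row_arr C S c e)"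
    unfolding mat_arr_def by (subst sum_arr_col[OF T T' w]) simp_all
  also have "\<dots> = col_arr C T' (row_arr C S (a' \<cdot> u) (b' \<cdot> v)) (row_arr C S (c' \<cdot> u) (e' \<cdot> v))"
    by (simp add: comp_row_arr[OF S] eq)
  also have "\<dots> = col_arr C T' (row_arr C S' a' b' \<cdot> sum_arr C S S' u v)
      (row_arr C S' c' e' \<cdot> sum_arr C S S' u v)"
    by (simp add: row_arr_sum[OF S S' u])
  also have "\<dots> = mat_arr C S' T' a' b' c' e' \<cdot> sum_arr C S S' u v"
    unfolding mat_arr_def by (subst col_arr_comp[OF T']) simp_all
  finally show ?thesis .
qed

end

text \<open>Indexed by the degree in \<open>Y\<close>, so it is the object of the reindexed cone at
  position \<open>Suc j\<close>; this removes the truncated subtraction \<open>i - 1\<close> of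
  \<open>mapping_cone\<close>.\<close>

definition cone_sum ::
  "('o, 'm) category \<Rightarrow> ('o, 'm) sequence \<Rightarrow> ('o, 'm) sequence \<Rightarrow> nat \<Rightarrow> ('o, 'm) biprod_data" where
  "cone_sum C X Y j = biprod C (obj X (Suc j)) (obj Y j)"

lemma mapping_cone_simps:
  fixes m :: nat
  shows "obj (mapping_cone (Suc m) C X Y f) 0 = obj X 0"
    and "j \<le> m \<Longrightarrow> obj (mapping_cone (Suc m) C X Y f) (Suc j) = sumobj (cone_sum C X Y j)"
    and "obj (mapping_cone (Suc m) C X Y f) (Suc (Suc m)) = obj Y (Suc m)"
    and "diff (mapping_cone (Suc m) C X Y f) 0 =
      col_arr C (cone_sum C X Y 0) (neg_arr C (diff X 0)) (f 0)"
    and "j < m \<Longrightarrow> diff (mapping_cone (Suc m) C X Y f) (Suc j) =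
      mat_arr C (cone_sum C X Y j) (cone_sum C X Y (Suc j))
        (neg_arr C (diff X (Suc j))) (zero_arr C (obj Y j) (obj X (Suc (Suc j))))
        (f (Suc j)) (diff Y j)"
    and "diff (mapping_cone (Suc m) C X Y f) (Suc m) =
      row_arr C (cone_sum C X Y m) (f (Suc m)) (diff Y m)"
  by (simp_all add: mapping_cone_def cone_sum_def)

lemma (in add_category) cone_composable:
  assumes f: "complex_mor C m X Y f"
  shows "composable_seq C (Suc m) (mapping_cone (Suc m) C X Y f)"
proof -
  note [simp] = complex_morD(5-7)[OF f]
    composable_seqD[OF complex_morD(3)[OF f]] composable_seqD[OF complex_morD(4)[OF f]]
  let ?K = "mapping_cone (Suc m) C X Y f"
  have S: "biproduct (obj X (Suc j)) (obj Y j) (cone_sum C X Y j)" if "j \<le> m" for j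
    unfolding cone_sum_def using that by (intro biproduct_biprod) simp_all
  have "obj ?K i \<in> Obj C" if "i \<le> Suc m + 1" for i
  proof -
    consider "i = 0" | j where "i = Suc j" "j \<le> m" | "i = Suc (Suc m)"
      using \<open>i \<le> Suc m + 1\<close> by (cases i) force+
    then show ?thesis by cases (use biproductD(3)[OF S] in \<open>simp_all add: mapping_cone_simps\<close>)
  qed
  moreover have "diff ?K i \<in> Hom C (obj ?K i) (obj ?K (i + 1))" if "i \<le> Suc m" for i
  proof -
    consider "i = 0" | j where "i = Suc j" "j < m" | "i = Suc m"
      using \<open>i \<le> Suc m\<close> by (cases i) force+
    then show ?thesis
    proof cases
      case 1
      then show ?thesis
        using col_arr_props[OF S[of 0]] by (simp add: mapping_cone_simps in_Hom)
    next
      case 2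
      then show ?thesis
        using mat_arr_props[OF S[of j] S[of "Suc j"]] by (simp add: mapping_cone_simps in_Hom)
    next
      case 3
      then show ?thesis
        using row_arr_props[OF S[of m]] by (simp add: mapping_cone_simps in_Hom)
    qed
  qed
  ultimately show ?thesis by (simp add: composable_seq_def)
qed

section \<open>Functor images of mapping cones\<close>

context equivalence_to_add
begin

text \<open>Biproducts are given by equations between arrows, sums and zero morphisms, all of which
  \<open>F\<close> preserves.\<close>

lemma biproduct_map:
  assumes "C.biproduct A B S"
  shows "D.biproduct (fobj F A) (fobj F B) (map_biprod F S)"
proof -
  note S = C.biproductD[OF assms]
  have "add_arr D (farr F (inj1 S) \<cdot>\<^bsub>D\<^esub> farr F (proj1 S)) (farr F (inj2 S) \<cdot>\<^bsub>D\<^esub> farr F (proj2 S)) =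
    Ide D (fobj F (sumobj S))"
    using S by (simp flip: farr_comp farr_add)
  then show ?thesis
    using S by (simp add: is_biproduct_def map_biprod_def in_Hom add_arr_def zero_arr_def[symmetric]
        flip: farr_comp)
qed

lemma farr_col:
  assumes "C.biproduct A B T" "a \<in> Arr C" "b \<in> Arr C" "Dom C b = Dom C a" "Cod C a = A" "Cod C b = B"
  shows "farr F (col_arr C T a b) = col_arr D (map_biprod F T) (farr F a) (farr F b)"
  using C.biproductD[OF assms(1)] assms(2-)
  by (simp add: col_arr_def map_biprod_def farr_add farr_comp)

lemma farr_row:
  assumes "C.biproduct A B S" "a \<in> Arr C" "b \<in> Arr C" "Cod C b = Cod C a" "Dom C a = A" "Dom C b = B"
  shows "farr F (row_arr C S a b) = row_arr D (map_biprod F S) (farr F a) (farr F b)"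
  using C.biproductD[OF assms(1)] assms(2-)
  by (simp add: row_arr_def map_biprod_def farr_add farr_comp)

lemma farr_mat:
  assumes S: "C.biproduct A B S" and T: "C.biproduct A' B' T"
    and m: "a \<in> Hom C A A'" "b \<in> Hom C B A'" "c \<in> Hom C A B'" "e \<in> Hom C B B'"
  shows "farr F (mat_arr C S T a b c e) =
    mat_arr D (map_biprod F S) (map_biprod F T) (farr F a) (farr F b) (farr F c) (farr F e)"
proof -
  note [simp] = m[unfolded in_Hom] C.row_arr_props[OF S]
  show ?thesis
    unfolding mat_arr_def by (subst farr_col[OF T]) (simp_all add: farr_row[OF S])
qed

text \<open>\<open>F\<close> sends the chosen biproducts of \<open>C\<close> to biproducts of
  \<open>D\<close>, though not to the chosen ones. Diagonal arrows built from
  \<open>\<alpha> (Suc j)\<close> and \<open>\<beta> j\<close> bridge this gap and at the same time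
  pass from \<open>F X\<close>, \<open>F Y\<close> to \<open>X'\<close>, \<open>Y'\<close>; in the
  two end degrees \<open>\<alpha> 0\<close> and \<open>\<beta> (Suc m)\<close> suffice.\<close>

lemma cone_transport:
  assumes f: "complex_mor C m X Y f" and f': "complex_mor D m X' Y' f'"
    and \<alpha>: "seq_iso D m (map_seq F X) X' \<alpha>" and \<beta>: "seq_iso D m (map_seq F Y) Y' \<beta>"
    and ff': "\<And>i. i \<le> m + 1 \<Longrightarrow> \<beta> i \<cdot>\<^bsub>D\<^esub> farr F (f i) = f' i \<cdot>\<^bsub>D\<^esub> \<alpha> i"
  obtains \<gamma> where "seq_iso D (Suc m) (map_seq F (mapping_cone (Suc m) C X Y f))
    (mapping_cone (Suc m) D X' Y' f') \<gamma>"
proof -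
  note [simp] = seq_isoD(3-6)[OF \<alpha>] composable_seqD[OF seq_isoD(2)[OF \<alpha>]]
  note [simp] = seq_isoD(3-6)[OF \<beta>] composable_seqD[OF seq_isoD(2)[OF \<beta>]]
  note [simp] = complex_morD(5-7)[OF f] complex_morD(5-7)[OF f']
    composable_seqD[OF complex_morD(3)[OF f]] composable_seqD[OF complex_morD(4)[OF f]]
  note \<alpha>d = seq_isoD(7)[OF \<alpha>, simplified] and \<beta>d = seq_isoD(7)[OF \<beta>, simplified]
  let ?K = "mapping_cone (Suc m) C X Y f" and ?K' = "mapping_cone (Suc m) D X' Y' f'"
  let ?S = "cone_sum C X Y" and ?S' = "cone_sum D X' Y'"
  let ?FS = "\<lambda>j. map_biprod F (?S j)"
  have S: "C.biproduct (obj X (Suc j)) (obj Y j) (?S j)" if "j \<le> m" for j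
    unfolding cone_sum_def using that by (intro C.biproduct_biprod) simp_all
  have S': "D.biproduct (obj X' (Suc j)) (obj Y' j) (?S' j)" if "j \<le> m" for j
    unfolding cone_sum_def using that by (intro D.biproduct_biprod) simp_all
  have FS: "D.biproduct (fobj F (obj X (Suc j))) (fobj F (obj Y j)) (?FS j)" if "j \<le> m" for j
    using biproduct_map S that by blast
  have sumobj_FS: "sumobj (?FS j) = fobj F (sumobj (?S j))" for j
    by (simp add: map_biprod_def)
  define \<sigma> where "\<sigma> j = sum_arr D (?FS j) (?S' j) (\<alpha> (Suc j)) (\<beta> j)" for j
  have \<alpha>\<beta>: "\<alpha> (Suc j) \<in> Hom D (fobj F (obj X (Suc j))) (obj X' (Suc j))"
    "\<beta> j \<in> Hom D (fobj F (obj Y j)) (obj Y' j)" if "j \<le> m" for j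
    using that by (simp_all add: in_Hom)
  have \<sigma>: "\<sigma> j \<in> Hom D (fobj F (sumobj (?S j))) (sumobj (?S' j))" "iso_arr D (\<sigma> j)" if j: "j \<le> m" for j
    using D.sum_arr_props(1-3)[OF FS S' \<alpha>\<beta>, OF j j j j]
      D.sum_arr_iso[OF FS S' \<alpha>\<beta>(1) _ \<alpha>\<beta>(2), OF j j j _ j] j
    by (simp_all add: \<sigma>_def in_Hom sumobj_FS)
  define \<gamma> where "\<gamma> i = (if i = 0 then \<alpha> 0 else if i \<le> Suc m then \<sigma> (i - 1) else \<beta> (Suc m))" for i
  have "\<gamma> i \<in> Hom D (obj (map_seq F ?K) i) (obj ?K' i) \<and> iso_arr D (\<gamma> i)" if "i \<le> Suc m + 1" for i
  proof -
    consider "i = 0" | j where "i = Suc j" "j \<le> m" | "i = Suc (Suc m)"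
      using \<open>i \<le> Suc m + 1\<close> by (cases i) force+
    then show ?thesis
      by cases (use \<sigma> in \<open>simp_all add: \<gamma>_def mapping_cone_simps in_Hom\<close>)
  qed
  moreover have "\<gamma> (i + 1) \<cdot>\<^bsub>D\<^esub> diff (map_seq F ?K) i = diff ?K' i \<cdot>\<^bsub>D\<^esub> \<gamma> i" if "i \<le> Suc m" for i
  proof -
    consider "i = 0" | j where "i = Suc j" "j < m" | "i = Suc m"
      using \<open>i \<le> Suc m\<close> by (cases i) force+
    then show ?thesis
    proof cases
      case 1
      have "\<gamma> 1 \<cdot>\<^bsub>D\<^esub> farr F (diff ?K 0) =
          \<sigma> 0 \<cdot>\<^bsub>D\<^esub> col_arr D (?FS 0) (neg_arr D (farr F (diff X 0))) (farr F (f 0))"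
        by (simp add: \<gamma>_def mapping_cone_simps farr_col[OF S] farr_neg)
      also have "\<dots> = col_arr D (?S' 0) (neg_arr D (diff X' 0) \<cdot>\<^bsub>D\<^esub> \<alpha> 0) (f' 0 \<cdot>\<^bsub>D\<^esub> \<alpha> 0)"
        unfolding \<sigma>_def
        by (subst D.sum_arr_col[OF FS S' \<alpha>\<beta>])
          (simp_all add: D.comp_neg D.neg_comp \<alpha>d ff')
      also have "\<dots> = diff ?K' 0 \<cdot>\<^bsub>D\<^esub> \<gamma> 0"
        by (simp add: \<gamma>_def mapping_cone_simps D.col_arr_comp[OF S'])
      finally show ?thesis using 1 by simp
    next
      case 2
      have j: "j \<le> m" "Suc j \<le> m" using 2 by simp_all
      have "\<gamma> (i + 1) \<cdot>\<^bsub>D\<^esub> farr F (diff ?K i) = \<sigma> (Suc j) \<cdot>\<^bsub>D\<^esub> mat_arr D (?FS j) (?FS (Suc j))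
          (neg_arr D (farr F (diff X (Suc j)))) (zero_arr D (fobj F (obj Y j)) (fobj F (obj X (Suc (Suc j)))))
          (farr F (f (Suc j))) (farr F (diff Y j))"
        using 2 by (simp add: \<gamma>_def mapping_cone_simps farr_mat[OF S S] farr_neg in_Hom)
      \<comment> \<open>The four entry conditions are the negated square of \<open>\<alpha>\<close>,
        the vanishing entry, the compatibility \<open>ff'\<close>, and the square of
        \<open>\<beta>\<close>.\<close>
      also have "\<dots> = mat_arr D (?S' j) (?S' (Suc j))
          (neg_arr D (diff X' (Suc j))) (zero_arr D (obj Y' j) (obj X' (Suc (Suc j))))
          (f' (Suc j)) (diff Y' j) \<cdot>\<^bsub>D\<^esub> \<sigma> j"
        unfolding \<sigma>_def
        by (rule D.sum_arr_mat[OF FS FS S' S'])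
          (use j in \<open>simp_all add: in_Hom D.comp_neg D.neg_comp \<alpha>d \<beta>d ff'\<close>)
      finally show ?thesis using 2 by (simp add: \<gamma>_def mapping_cone_simps)
    next
      case 3
      have "\<gamma> (i + 1) \<cdot>\<^bsub>D\<^esub> farr F (diff ?K i) =
          \<beta> (Suc m) \<cdot>\<^bsub>D\<^esub> row_arr D (?FS m) (farr F (f (Suc m))) (farr F (diff Y m))"
        using 3 by (simp add: \<gamma>_def mapping_cone_simps farr_row[OF S])
      also have "\<dots> = row_arr D (?FS m) (f' (Suc m) \<cdot>\<^bsub>D\<^esub> \<alpha> (Suc m)) (diff Y' m \<cdot>\<^bsub>D\<^esub> \<beta> m)"
        by (subst D.comp_row_arr[OF FS]) (simp_all add: \<beta>d ff')
      also have "\<dots> = row_arr D (?S' m) (f' (Suc m)) (diff Y' m) \<cdot>\<^bsub>D\<^esub> \<sigma> m"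
        unfolding \<sigma>_def by (subst D.row_arr_sum[OF FS S' \<alpha>\<beta>]) simp_all
      finally show ?thesis using 3 by (simp add: \<gamma>_def mapping_cone_simps)
    qed
  qed
  moreover have "composable_seq D (Suc m) (map_seq F ?K)"
    by (rule map_composable[OF C.cone_composable[OF f]])
  moreover have "composable_seq D (Suc m) ?K'"
    by (rule D.cone_composable[OF f'])
  ultimately have "seq_iso D (Suc m) (map_seq F ?K) ?K' \<gamma>"
    by (simp add: seq_iso_def)
  then show ?thesis by (rule that)
qed

end

section \<open>Transport of \<open>n\<close>-exact structures\<close>

context equivalence_to_add
begin

text \<open>The prescribed component of the result is whatever conjugation yields. Choosing the end
  components of \<open>\<alpha>\<close> and \<open>\<beta>\<close> so that it becomes a given arrow
  is left to the application.\<close>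

lemma
  assumes n: "n \<ge> 1" and \<alpha>: "seq_iso D (n - 1) (map_seq F X) X' \<alpha>"
    and \<beta>: "seq_iso D (n - 1) (map_seq F Y) Y' \<beta>"
  defines "f' \<equiv> \<lambda>f i. \<beta> i \<cdot>\<^bsub>D\<^esub> (farr F (f i) \<cdot>\<^bsub>D\<^esub> inv_arr D (\<alpha> i))"
  shows n_pushout_transport: "n_pushout n C X h Y f \<Longrightarrow> n_pushout n D X' (f' f 0) Y' (f' f)"
    and n_pullback_transport: "n_pullback n C Y h X f \<Longrightarrow> n_pullback n D Y' (f' f n) X' (f' f)"
proof -
  obtain m where m: "n = Suc m" using n by (cases n) auto
  have cone: "complex_mor D m X' Y' (f' f) \<and> (\<exists>\<gamma>. seq_iso D n
      (map_seq F (mapping_cone n C X Y f)) (mapping_cone n D X' Y' (f' f)) \<gamma>)"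
    if f: "complex_mor C m X Y f" for f
  proof -
    have f': "complex_mor D m X' Y' (f' f)"
      using complex_mor_transport[OF f] \<alpha> \<beta> by (simp add: m f'_def)
    note \<alpha>' = \<alpha>[unfolded m, simplified] and \<beta>' = \<beta>[unfolded m, simplified]
    note [simp] = complex_morD(5-7)[OF f] seq_isoD(3-6)[OF \<alpha>'] seq_isoD(3-6)[OF \<beta>']
    have "\<beta> i \<cdot>\<^bsub>D\<^esub> farr F (f i) = f' f i \<cdot>\<^bsub>D\<^esub> \<alpha> i" if "i \<le> m + 1" for i
      using that by (simp add: f'_def)
    from cone_transport[OF f f' \<alpha>' \<beta>' this] f' show ?thesis
      unfolding m by blast
  qed
  show "n_pushout n D X' (f' f 0) Y' (f' f)" if "n_pushout n C X h Y f"
    using that cone[of f] n_cokernel_transport by (auto simp: n_pushout_def m)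
  show "n_pullback n D Y' (f' f n) X' (f' f)" if "n_pullback n C Y h X f"
    using that cone[of f] n_kernel_transport by (auto simp: n_pullback_def m)
qed

end

text \<open>Separated from \<open>n_exact_category\<close> so that its consequences are available
  for the transported class before the remaining axioms are verified for that class.\<close>

locale weak_iso_closed_class = add_category C
  for C :: "('o, 'm) category" (structure) and n :: nat and \<X> :: "('o, 'm) sequence set" +
  assumes class_exact: "X \<in> \<X> \<Longrightarrow> n_exact_seq n C X"
    and class_closed: "\<lbrakk>X \<in> \<X>; weakly_isomorphic n C X Y\<rbrakk> \<Longrightarrow> Y \<in> \<X>"
begin

lemma class_composable: "X \<in> \<X> \<Longrightarrow> composable_seq C n X"
  using class_exact by (simp add: n_exact_seq_def n_kernel_def)

lemma class_seq_iso:
  assumes "X \<in> \<X>" "seq_iso C n X Y \<phi>"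
  shows "Y \<in> \<X>"
  using assms class_closed class_exact n_exact_seq_iso seq_iso_weakly_isomorphic by blast

text \<open>Admissibility asks for literal equality with a differential. Replacing the two objects
  in degrees \<open>k\<close> and \<open>k + 1\<close> turns an arrow isomorphic to
  \<open>diff X k\<close> into such a differential; \<open>k = 0\<close> and \<open>k = n\<close>
  are the cases of monomorphisms and epimorphisms.\<close>

lemma class_change_diff:
  assumes X: "X \<in> \<X>" and k: "k \<le> n" and a: "a \<in> Arr C"
    and u: "u \<in> Hom C (obj X k) (Dom C a)" "iso_arr C u"
    and v: "v \<in> Hom C (obj X (k + 1)) (Cod C a)" "iso_arr C v"
    and eq: "v \<cdot> diff X k = a \<cdot> u"
  shows "\<exists>Y \<in> \<X>. a = diff Y k"
proof -
  note [simp] = composable_seqD[OF class_composable[OF X]]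
  define \<beta> where "\<beta> i = (if i = k then u else if i = k + 1 then v else Ide C (obj X i))" for i
  have "seq_iso C n X (transport_seq C X \<beta>) \<beta>"
    by (intro seq_iso_transport class_composable X) (use u v in \<open>auto simp: \<beta>_def in_Hom\<close>)
  then have "transport_seq C X \<beta> \<in> \<X>" using X class_seq_iso by blast
  moreover have "diff (transport_seq C X \<beta>) k = (v \<cdot> diff X k) \<cdot> inv_arr C u"
    using u v k by (simp add: transport_seq_def \<beta>_def in_Hom)
  then have "diff (transport_seq C X \<beta>) k = a"
    using u a by (simp add: eq in_Hom)
  ultimately show ?thesis by blast
qed

end

sublocale n_exact_category \<subseteq> weak_iso_closed_class C n \<X>
proof -
  interpret category C using additive by (simp add: additive_category_def)
  show "weak_iso_closed_class C n \<X>"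
    by unfold_locales (fact additive n_exact weak_iso_closed)+
qed

text \<open>Both natural isomorphisms point towards the identity, so that they yield isomorphisms
  starting at a mapped sequence, the shape expected by the transport lemmas.\<close>

locale exact_equivalence = C: n_exact_category n C \<X> +
  F: equivalence_to_add C D F + G: equivalence_to_add D C G
  for n :: nat and C :: "('o, 'm) category" and \<X> :: "('o, 'm) sequence set"
    and D :: "('p, 'k) category" and F G +
  fixes \<eta> \<epsilon>
  assumes n_pos: "n \<ge> 1"
    and \<eta>: "natural_iso C C (comp_functor G F) id_functor \<eta>"
    and \<epsilon>: "natural_iso D D (comp_functor F G) id_functor \<epsilon>"
begin

lemmas \<eta>_props = natural_isoD[OF \<eta>, simplified id_functor_def comp_functor_def, simplified]
lemmas \<epsilon>_props = natural_isoD[OF \<epsilon>, simplified id_functor_def comp_functor_def, simplified]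

lemma
  shows \<eta>_natural: "\<lbrakk>f \<in> Arr C; Dom C f = A; Cod C f = B\<rbrakk>
      \<Longrightarrow> \<eta> B \<cdot>\<^bsub>C\<^esub> farr G (farr F f) = f \<cdot>\<^bsub>C\<^esub> \<eta> A"
    and \<epsilon>_natural: "\<lbrakk>g \<in> Arr D; Dom D g = A'; Cod D g = B'\<rbrakk>
      \<Longrightarrow> \<epsilon> B' \<cdot>\<^bsub>D\<^esub> farr F (farr G g) = g \<cdot>\<^bsub>D\<^esub> \<epsilon> A'"
  using \<eta>_props(5) \<epsilon>_props(5) by blast+

lemma seq_iso_\<epsilon>:
  "composable_seq D m Y \<Longrightarrow> seq_iso D m (map_seq F (map_seq G Y)) Y (\<lambda>i. \<epsilon> (obj Y i))"
  using composable_seqD[of D m Y] \<epsilon>_props(1-4) \<epsilon>_natural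
  by (simp add: seq_iso_def F.map_composable G.map_composable in_Hom)

lemma seq_iso_\<eta>:
  "composable_seq C m X \<Longrightarrow> seq_iso C m (map_seq G (map_seq F X)) X (\<lambda>i. \<eta> (obj X i))"
  using composable_seqD[of C m X] \<eta>_props(1-4) \<eta>_natural
  by (simp add: seq_iso_def F.map_composable G.map_composable in_Hom)

definition image_class :: "('p, 'k) sequence set" where
  "image_class = {Y. \<exists>X \<in> \<X>. weakly_isomorphic n D Y (map_seq F X)}"

text \<open>From left to right, \<open>G Y\<close> is joined to a member of \<X> by two weak
  isomorphisms, through \<open>G (F X)\<close>, and \<X> absorbs both. From right to left,
  \<open>\<epsilon>\<close> makes \<open>Y\<close> isomorphic to \<open>F (G Y)\<close>.
  Composability is stated separately because \<open>G\<close> is unspecified on entries outside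
  \<open>D\<close>, so membership of \<open>map_seq G Y\<close> says nothing about them.\<close>

lemma image_class_iff:
  "Y \<in> image_class \<longleftrightarrow> composable_seq D n Y \<and> map_seq G Y \<in> \<X>"
proof
  assume "Y \<in> image_class"
  then obtain X where X: "X \<in> \<X>" "weakly_isomorphic n D Y (map_seq F X)"
    by (auto simp: image_class_def)
  have "n_exact_seq n C (map_seq G (map_seq F X))"
    using X C.class_exact F.n_exact_map G.n_exact_map by blast
  then have "weakly_isomorphic n C (map_seq G (map_seq F X)) X"
    using X C.class_exact C.class_composable seq_iso_\<eta> seq_iso_weakly_isomorphic by blast
  then have "map_seq G (map_seq F X) \<in> \<X>"
    using X C.class_closed weakly_isomorphic_sym by blast
  then have "map_seq G Y \<in> \<X>"
    using G.weakly_isomorphic_map[OF X(2)] C.class_closed weakly_isomorphic_sym by blast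
  moreover have "composable_seq D n Y"
    using weakly_isomorphic_n_exact[OF X(2)] by (simp add: n_exact_seq_def n_kernel_def)
  ultimately show "composable_seq D n Y \<and> map_seq G Y \<in> \<X>" by blast
next
  assume Y: "composable_seq D n Y \<and> map_seq G Y \<in> \<X>"
  then have FG: "n_exact_seq n D (map_seq F (map_seq G Y))"
    using C.class_exact F.n_exact_map by blast
  moreover have "n_exact_seq n D Y"
    using Y F.D.n_exact_seq_iso[OF seq_iso_\<epsilon> FG] by blast
  ultimately have "weakly_isomorphic n D Y (map_seq F (map_seq G Y))"
    using Y seq_iso_\<epsilon> seq_iso_weakly_isomorphic weakly_isomorphic_sym by blast
  then show "Y \<in> image_class" using Y by (auto simp: image_class_def)
qed

sublocale image: weak_iso_closed_class D n image_class
proof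
  show "n_exact_seq n D Y" if "Y \<in> image_class" for Y
    using that weakly_isomorphic_n_exact by (auto simp: image_class_def)
  show "Y \<in> image_class" if "X \<in> image_class" "weakly_isomorphic n D X Y" for X Y
    using that G.weakly_isomorphic_map[OF that(2)] C.class_closed weakly_isomorphic_n_exact[OF that(2)]
    by (auto simp: image_class_iff n_exact_seq_def n_kernel_def)
qed

lemma map_seq_image_class:
  assumes "X \<in> \<X>"
  shows "map_seq F X \<in> image_class"
proof -
  have "weakly_isomorphic n D (map_seq F X) (map_seq F X)"
    using assms C.class_exact C.class_composable F.n_exact_map F.seq_iso_map
      seq_iso_weakly_isomorphic by blast
  then show ?thesis using assms by (auto simp: image_class_def)
qed

lemma image_class_diff:
  assumes X: "X \<in> \<X>" and k: "k \<le> n" and a: "a \<in> Arr D"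
    and u: "u \<in> Hom D (fobj F (Dom C (diff X k))) (Dom D a)" "iso_arr D u"
    and v: "v \<in> Hom D (fobj F (Cod C (diff X k))) (Cod D a)" "iso_arr D v"
    and eq: "v \<cdot>\<^bsub>D\<^esub> farr F (diff X k) = a \<cdot>\<^bsub>D\<^esub> u"
  shows "\<exists>Y \<in> image_class. a = diff Y k"
  using image.class_change_diff[OF map_seq_image_class[OF X] k a _ u(2) _ v(2)] u v eq k
    composable_seqD[OF C.class_composable[OF X]] by auto

text \<open>By naturality of \<open>\<epsilon>\<close>, the arrow \<open>a\<close> is isomorphic to
  \<open>farr F (farr G a)\<close>, the image of a differential of a member of \<X>.\<close>

lemma image_class_diff_reflect:
  assumes X: "X \<in> \<X>" and k: "k \<le> n" and a: "a \<in> Arr D" and eq: "farr G a = diff X k"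
  shows "\<exists>Y \<in> image_class. a = diff Y k"
  by (rule image_class_diff[OF X k a, of "\<epsilon> (Dom D a)" "\<epsilon> (Cod D a)"])
    (use a \<epsilon>_props in \<open>simp_all add: in_Hom flip: eq\<close>)

section \<open>Verification of the axioms for \<open>image_class\<close>\<close>

lemma zero_sequence_image_class:
  assumes Z: "zero_object D Z"
  shows "\<lparr>obj = (\<lambda>_. Z), diff = (\<lambda>_. Ide D Z)\<rparr> \<in> image_class"
proof -
  have ZO: "Z \<in> Obj D" using Z by (simp add: zero_object_def)
  \<comment> \<open>\<open>G Z\<close> is shown to be zero by reflection along \<open>F\<close>,
    using that \<open>F (G Z)\<close> is isomorphic to \<open>Z\<close>.\<close>
  then have "zero_object D (fobj F (fobj G Z))"
    using \<epsilon>_props(1-4) by (intro zero_object_iso[OF F.D.category_axioms Z, of "\<epsilon> Z"]) (simp_all add: in_Hom)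
  then have "zero_object C (fobj G Z)"
    using F.zero_object_reflect ZO by simp
  then show ?thesis
    using C.E0[of "fobj G Z"] ZO
    by (simp add: image_class_iff composable_seq_def map_seq_def in_Hom)
qed

text \<open>The pushout is formed in \<open>C\<close> from \<open>map_seq G X\<close> along
  \<open>farr G h\<close> and mapped by \<open>F\<close>. The source is moved back to
  \<open>X\<close> by \<open>\<epsilon>\<close> in every degree; on the target only degree 0 is
  prescribed.\<close>

lemma image_class_pushout:
  assumes X: "X \<in> image_class" and h: "h \<in> Hom D (obj X 0) B"
  shows "\<exists>Y f. n_pushout n D X h Y f \<and> admissible_mono image_class (diff Y 0)"
proof -
  note h' = h[unfolded in_Hom]
  have B: "B \<in> Obj D" using h' by auto
  have Xc: "composable_seq D n X" and GX: "map_seq G X \<in> \<X>" using X by (simp_all add: image_class_iff)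
  then have Xc': "composable_seq D (n - 1) X" by (simp add: composable_seq_def)
  note [simp] = composable_seqD[OF Xc] \<epsilon>_props(1-4) h' B
  have "farr G h \<in> Hom C (obj (map_seq G X) 0) (fobj G B)" by (simp add: in_Hom)
  from C.E2[OF GX this] obtain Y f W where po: "n_pushout n C (map_seq G X) (farr G h) Y f"
    and W: "W \<in> \<X>" "diff Y 0 = diff W 0"
    by (auto simp: admissible_mono_def)
  have f: "complex_mor C (n - 1) (map_seq G X) Y f" and f0: "f 0 = farr G h"
    using po by (simp_all add: n_pushout_def)
  note [simp] = composable_seqD[OF complex_morD(4)[OF f]]
  have Y0: "obj Y 0 = fobj G B" using complex_morD(7)[OF f, of 0] f0 by simp
  \<comment> \<open>Turns \<open>F (G B)\<close> into \<open>B\<close> in degree 0 and changes no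
    other object; naturality of \<open>\<epsilon>\<close> then makes the 0-th component exactly
    \<open>h\<close>.\<close>
  define \<beta> where "\<beta> i = (if i = 0 then \<epsilon> B else Ide D (fobj F (obj Y i)))" for i
  define Y' where "Y' = transport_seq D (map_seq F Y) \<beta>"
  have \<beta>: "seq_iso D (n - 1) (map_seq F Y) Y' \<beta>"
    unfolding Y'_def using F.map_composable[OF complex_morD(4)[OF f]]
    by (rule F.D.seq_iso_transport) (simp_all add: \<beta>_def Y0)
  have "\<beta> 0 \<cdot>\<^bsub>D\<^esub> (farr F (f 0) \<cdot>\<^bsub>D\<^esub> inv_arr D (\<epsilon> (obj X 0))) =
      (\<epsilon> B \<cdot>\<^bsub>D\<^esub> farr F (farr G h)) \<cdot>\<^bsub>D\<^esub> inv_arr D (\<epsilon> (obj X 0))"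
    by (simp add: \<beta>_def f0)
  also have "\<dots> = h"
    by (simp add: \<epsilon>_natural)
  finally have "n_pushout n D X h Y'
      (\<lambda>i. \<beta> i \<cdot>\<^bsub>D\<^esub> (farr F (f i) \<cdot>\<^bsub>D\<^esub> inv_arr D (\<epsilon> (obj X i))))"
    using F.n_pushout_transport[OF n_pos seq_iso_\<epsilon>[OF Xc'] \<beta> po] by simp
  \<comment> \<open>\<open>Y\<close> matters only up to degree \<open>n\<close> and shares just its
    first differential with the member \<open>W\<close>; \<open>diff Y' 0\<close> is isomorphic to
    the image of that differential.\<close>
  moreover have "\<exists>V \<in> image_class. diff Y' 0 = diff V 0"
    by (rule image_class_diff[OF W(1), of 0 "diff Y' 0" "\<beta> 0" "\<beta> 1"])
      (use seq_isoD(3-7)[OF \<beta>, of 0] seq_isoD(3-7)[OF \<beta>, of 1] composable_seqD[OF seq_isoD(2)[OF \<beta>], of 0]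
        in \<open>simp_all add: in_Hom flip: W(2)\<close>)
  ultimately show ?thesis by (auto simp: admissible_mono_def)
qed

text \<open>Dual to the pushout, with shifted degrees: \<open>obj X (n + 1)\<close> has degree
  \<open>n\<close> in \<open>tail_seq X\<close>, so degree \<open>n\<close> is the one corrected by
  \<open>\<epsilon> B\<close>. The last differential of \<open>Z\<close> has index
  \<open>n - 1\<close>, but index \<open>n\<close> in the admissible sequence
  \<open>W\<close>.\<close>

lemma image_class_pullback:
  assumes X: "X \<in> image_class" and h: "h \<in> Hom D B (obj X (n + 1))"
  shows "\<exists>Z g. n_pullback n D (tail_seq X) h Z g \<and> admissible_epi n image_class (diff Z (n - 1))"
proof -
  note h' = h[unfolded in_Hom]
  have B: "B \<in> Obj D" using h' by auto
  have Xc: "composable_seq D n X" and GX: "map_seq G X \<in> \<X>" using X by (simp_all add: image_class_iff)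
  then have Xc': "composable_seq D (n - 1) (tail_seq X)"
    using n_pos by (auto simp: composable_seq_def tail_seq_def)
  note [simp] = composable_seqD[OF Xc] \<epsilon>_props(1-4) h' B
  have "farr G h \<in> Hom C (fobj G B) (obj (map_seq G X) (n + 1))" by (simp add: in_Hom)
  from C.E2_op[OF GX this] obtain Z g W
    where pb: "n_pullback n C (tail_seq (map_seq G X)) (farr G h) Z g"
    and W: "W \<in> \<X>" "diff Z (n - 1) = diff W n"
    by (auto simp: admissible_epi_def)
  have tail: "tail_seq (map_seq G X) = map_seq G (tail_seq X)"
    by (simp add: tail_seq_def map_seq_def)
  have g: "complex_mor C (n - 1) Z (map_seq G (tail_seq X)) g" and gn: "g n = farr G h"
    using pb by (simp_all add: n_pullback_def tail)
  note [simp] = composable_seqD[OF complex_morD(3)[OF g]]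
  have Zn: "obj Z n = fobj G B" using complex_morD(6)[OF g, of n] gn by simp
  define \<beta> where "\<beta> i = (if i = n then \<epsilon> B else Ide D (fobj F (obj Z i)))" for i
  define Z' where "Z' = transport_seq D (map_seq F Z) \<beta>"
  have \<beta>: "seq_iso D (n - 1) (map_seq F Z) Z' \<beta>"
    unfolding Z'_def using F.map_composable[OF complex_morD(3)[OF g]]
    by (rule F.D.seq_iso_transport) (auto simp: \<beta>_def Zn)
  have "\<epsilon> (obj (tail_seq X) n) \<cdot>\<^bsub>D\<^esub> (farr F (g n) \<cdot>\<^bsub>D\<^esub> inv_arr D (\<beta> n)) =
      (\<epsilon> (obj X (n + 1)) \<cdot>\<^bsub>D\<^esub> farr F (farr G h)) \<cdot>\<^bsub>D\<^esub> inv_arr D (\<epsilon> B)"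
    by (simp add: \<beta>_def gn tail_seq_def)
  also have "\<dots> = h"
    by (simp add: \<epsilon>_natural)
  finally have "n_pullback n D (tail_seq X) h Z'
      (\<lambda>i. \<epsilon> (obj (tail_seq X) i) \<cdot>\<^bsub>D\<^esub> (farr F (g i) \<cdot>\<^bsub>D\<^esub> inv_arr D (\<beta> i)))"
    using F.n_pullback_transport[OF n_pos \<beta> seq_iso_\<epsilon>[OF Xc'] pb[unfolded tail]] by simp
  moreover have "\<exists>V \<in> image_class. diff Z' (n - 1) = diff V n"
    by (rule image_class_diff[OF W(1), of n "diff Z' (n - 1)" "\<beta> (n - 1)" "\<beta> n"])
      (use seq_isoD(3-7)[OF \<beta>, of "n - 1"] seq_isoD(3-7)[OF \<beta>, of n]
        composable_seqD[OF seq_isoD(2)[OF \<beta>], of "n - 1"] n_pos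
        in \<open>simp_all add: in_Hom flip: W(2)\<close>)
  ultimately show ?thesis by (auto simp: admissible_epi_def)
qed

text \<open>Being a \<open>k\<close>-th differential of a member is preserved and reflected by
  \<open>G\<close>, so closure under composition can be tested in \<open>C\<close>. The parameter
  \<open>k\<close> covers monomorphisms and epimorphisms together.\<close>

lemma image_class_comp:
  assumes closed: "\<And>a b. \<lbrakk>\<exists>X \<in> \<X>. a = diff X k; \<exists>X \<in> \<X>. b = diff X k; Cod C a = Dom C b\<rbrakk>
      \<Longrightarrow> \<exists>X \<in> \<X>. b \<cdot>\<^bsub>C\<^esub> a = diff X k"
    and k: "k \<le> n" and ab: "\<exists>X \<in> image_class. a = diff X k" "\<exists>X \<in> image_class. b = diff X k"
    and dom: "Cod D a = Dom D b"
  shows "\<exists>X \<in> image_class. b \<cdot>\<^bsub>D\<^esub> a = diff X k"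
proof -
  have *: "c \<in> Arr D \<and> (\<exists>X \<in> \<X>. farr G c = diff X k)" if "\<exists>X \<in> image_class. c = diff X k" for c
    using that k composable_seqD(2)[OF image.class_composable]
    by (auto simp: image_class_iff) (metis map_seq_simps(2))
  have "\<exists>X \<in> \<X>. farr G (b \<cdot>\<^bsub>D\<^esub> a) = diff X k"
    using closed[of "farr G a" "farr G b"] *[OF ab(1)] *[OF ab(2)] dom
    by (simp add: G.farr_comp)
  then show ?thesis
    using image_class_diff_reflect[OF _ k, of _ "b \<cdot>\<^bsub>D\<^esub> a"] *[OF ab(1)] *[OF ab(2)] dom
    by (metis F.D.comp_arr(1))
qed

lemma image_n_exact_category: "n_exact_category n D image_class"
proof
  show "additive_category D" by (rule F.D.additive)
  show "n_exact_seq n D X" if "X \<in> image_class" for X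
    by (rule image.class_exact[OF that])
  show "Y \<in> image_class" if "X \<in> image_class" "weakly_isomorphic n D X Y" for X Y
    by (rule image.class_closed[OF that])
  show "\<lparr>obj = (\<lambda>_. Z), diff = (\<lambda>_. Ide D Z)\<rparr> \<in> image_class" if "zero_object D Z" for Z
    by (rule zero_sequence_image_class[OF that])
  show "admissible_mono image_class (b \<cdot>\<^bsub>D\<^esub> a)"
    if "admissible_mono image_class a" "admissible_mono image_class b" "Cod D a = Dom D b" for a b
    using image_class_comp[of 0] C.E1 that unfolding admissible_mono_def by blast
  show "admissible_epi n image_class (b \<cdot>\<^bsub>D\<^esub> a)"
    if "admissible_epi n image_class a" "admissible_epi n image_class b" "Cod D a = Dom D b" for a b
    using image_class_comp[of n] C.E1_op that unfolding admissible_epi_def by blast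
  show "\<exists>Y f. n_pushout n D X h Y f \<and> admissible_mono image_class (diff Y 0)"
    if "X \<in> image_class" "h \<in> Hom D (obj X 0) B" for X h B
    by (rule image_class_pushout[OF that])
  show "\<exists>Z g. n_pullback n D (tail_seq X) h Z g \<and> admissible_epi n image_class (diff Z (n - 1))"
    if "X \<in> image_class" "h \<in> Hom D B (obj X (n + 1))" for X h B
    by (rule image_class_pullback[OF that])
qed

end

theorem theorem3p5:
  fixes n :: nat
    and C :: "('o, 'm) category" and \<X> :: "('o, 'm) sequence set"
    and C' :: "('p, 'k) category" and \<X>' :: "('p, 'k) sequence set"
    and F :: "('o, 'm, 'p, 'k) cat_functor"
  assumes "n \<ge> 1"
    and "n_exact_category n C \<X>"
    and "category C'"
    and "is_equivalence C C' F"
    and "\<X>' = {Y. \<exists>X \<in> \<X>. weakly_isomorphic n C' Y (map_seq F X)}"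
  shows "n_exact_category n C' \<X>' \<and> n_exact_equivalence n C \<X> C' \<X>' F"
proof -
  interpret C: n_exact_category n C \<X> by fact
  obtain G \<eta> \<epsilon> where F: "is_functor C C' F" and G: "is_functor C' C G"
    and \<eta>: "natural_iso C C id_functor (comp_functor G F) \<eta>"
    and \<epsilon>: "natural_iso C' C' (comp_functor F G) id_functor \<epsilon>"
    using assms(4) unfolding is_equivalence_def by blast
  note inverse = equivalence_inverse[OF C.category_axioms assms(3) F G \<eta> \<epsilon>]
  \<comment> \<open>\<open>G\<close> comes before \<open>F\<close> because only its target
    \<open>C\<close> is known to be additive; this instance supplies additivity of
    \<open>C'\<close>, which the instance for \<open>F\<close> requires.\<close>
  interpret G: equivalence_to_add C' C G
    using equivalence_imp_fully_faithful_ess_surj[OF assms(3) C.category_axioms G F inverse(2,1)]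
      C.add_category_axioms by (simp add: equivalence_to_add_def)
  interpret F: equivalence_to_add C C' F
    using equivalence_imp_fully_faithful_ess_surj[OF C.category_axioms assms(3) F G \<eta> \<epsilon>]
      G.C.add_category_axioms by (simp add: equivalence_to_add_def)
  \<comment> \<open>\<open>\<eta>\<close> is inverted here to point from \<open>G F\<close> to the
    identity; \<open>\<epsilon>\<close> already points that way.\<close>
  interpret exact_equivalence n C \<X> C' F G "\<lambda>A. inv_arr C (\<eta> A)" \<epsilon>
    by unfold_locales (fact assms(1) inverse(1) \<epsilon>)+
  have "\<X>' = image_class" using assms(5) by (simp add: image_class_def)
  then show ?thesis
    using image_n_exact_category assms(2,4) F.farr_additive map_seq_image_class
    by (simp add: n_exact_equivalence_def n_exact_functor_def)
qed

end
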